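(* Let $\mathcal{E}: \mathbf{1} \to \mathcal{K} \to \mathcal{H} \xrightarrow{(\pi_1,\pi_2)} \mathcal{A} \to \mathbf{1}$ be an abelian extension of a relative Rota--Baxter group $\mathcal{A}=(A,B,\beta,T)$ by a trivial relative Rota--Baxter group $\mathcal{K}=(K,L,\alpha,S)$, where $\mathcal{H}=(H,G,\phi,R)$, such that $[\mathcal{E}]\in\mathrm{Ext}_{(\nu,\mu,\sigma,f)}(\mathcal{A},\mathcal{K})$. Then there is an isomorphism of groups $\mathrm{Aut}^{\mathcal{A},\mathcal{K}}(\mathcal{H})\cong\mathrm{Z}^1_{RRB}(\mathcal{A},\mathcal{K})$.
   Context: **Relative Rota--Baxter groups.** A relative Rota--Baxter group is a quadruple $(H,G,\phi,R)$ where $H,G$ are groups, $\phi:G\to\mathrm{Aut}(H)$, $g\mapsto\phi_g$, is a homomorphism and $R:H\to G$ is a map with $R(h_1)R(h_2)=R(h_1\phi_{R(h_1)}(h_2))$ for all $h_1,h_2\in H$. It is trivial if $\phi$ is the trivial homomorphism (then $R$ is a homomorphism). A homomorphism $(H,G,\phi,R)\to(K,L,\varphi,S)$ is a pair $(\psi,\eta)$ of group homomorphisms $\psi:H\to K$, $\eta:G\to L$ with $\eta R=S\psi$ and $\psi\phi_g=\varphi_{\eta(g)}\psi$ for all $g\in G$; it is an isomorphism if both are group isomorphisms. $\mathrm{Aut}(\cdot)$ denotes the automorphism group. **Abelian extensions.** An extension of $\mathcal{A}=(A,B,\beta,T)$ by $\mathcal{K}=(K,L,\alpha,S)$ is a sequence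 $\mathbf 1\to\mathcal{K}\xrightarrow{(i_1,i_2)}\mathcal{H}=(H,G,\phi,R)\xrightarrow{(\pi_1,\pi_2)}\mathcal{A}\to\mathbf 1$ of homomorphisms of relative Rota--Baxter groups with $i_1,i_2$ injective, $\pi_1,\pi_2$ surjective, $\mathrm{im}(i_1)=\ker\pi_1$ and $\mathrm{im}(i_2)=\ker\pi_2$. It is abelian if $K,L$ are abelian and $\mathcal{K}$ is trivial. $K,L$ are identified with their images under $i_1,i_2$. Two extensions of $\mathcal{A}$ by $\mathcal{K}$ are equivalent if there is an isomorphism between the middle terms compatible with the identity maps of $\mathcal{K}$ and $\mathcal{A}$; $[\mathcal{E}]$ is the class of $\mathcal{E}$. All groups are written multiplicatively. **Associated action.** Let $s_H:A\to H$, $s_G:B\to G$ be set-theoretic sections of $\pi_1,\pi_2$ with $s_H(1)=1$, $s_G(1)=1$. The action associated with $\mathcal{E}$ is the quadruple $(\nu,\mu,\sigma,f)$ with $\nu:B\to\mathrm{Aut}(K)$, $\mu:A\to\mathrm{Aut}(K)$, $\sigma:B\to\mathrm{Aut}(L)$, $f:L\times A\to K$: $\nu_b(k)=\phi_{s_G(b)}(k)$, $\mu_a(k)=s_H(a)^{-1}ks_H(a)$, $\sigma_b(l)=s_G(b)^{-1}l\,s_G(b)$, $f(l,a)=s_H(a)^{-1}\phi_l(s_H(a))$; these do not depend on the sections. $\mathrm{Ext}_{(\nu,\mu,\sigma,f)}(\mathcal{A},\mathcal{K})$ is the set of equivalence classes of abelian extensions of $\mathcal{A}$ by $\mathcal{K}$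 with associated action $(\nu,\mu,\sigma,f)$. **$\mathrm Z^1_{RRB}(\mathcal{A},\mathcal{K})$** is the group (pointwise multiplication) of pairs of maps $\kappa_1:A\to K$, $\kappa_2:B\to L$ with $\kappa_1(1)=1$, $\kappa_2(1)=1$ such that for all $a,a_1,a_2\in A$, $b,b_1,b_2\in B$: $\kappa_1(a_1a_2)=\kappa_1(a_2)\mu_{a_2}(\kappa_1(a_1))$; $\kappa_2(b_1b_2)=\kappa_2(b_2)\sigma_{b_2}(\kappa_2(b_1))$; $\nu_b(f(\kappa_2(b),a)\kappa_1(a))=\kappa_1(\beta_b(a))$; $S(\nu^{-1}_{T(a)}(\kappa_1(a)))=\kappa_2(T(a))$. **Automorphism groups.** $\mathrm{Aut}_{\mathcal{K}}(\mathcal{H})$ is the subgroup of $\gamma=(\gamma_1,\gamma_2)\in\mathrm{Aut}(\mathcal{H})$ normalizing $\mathcal{K}$, i.e. $\gamma_1(K)=K$ and $\gamma_2(L)=L$. For such $\gamma$ let $\gamma_{\mathcal{K}}=(\gamma_1|_K,\gamma_2|_L)$ and let $\gamma_{\mathcal{A}}$ be the induced automorphism of $\mathcal{A}$, with components $a\mapsto\pi_1(\gamma_1(s_H(a)))$ and $b\mapsto\pi_2(\gamma_2(s_G(b)))$. $\mathrm{Aut}^{\mathcal{A},\mathcal{K}}(\mathcal{H})$ is the subgroup of those $\gamma\in\mathrm{Aut}_{\mathcal{K}}(\mathcal{H})$ for which $\gamma_{\mathcal{K}}$ and $\gamma_{\mathcal{A}}$ are the identity automorphisms. *)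

theory Defs
  imports "HOL-Algebra.Coset" "HOL-Algebra.Bij"
begin

section \<open>Relative Rota--Baxter groups\<close>

text \<open>The quadruple \<open>(H, G, \<phi>, R)\<close>.\<close>

record ('h, 'g) rrb =
  rrbH :: "'h monoid"
  rrbG :: "'g monoid"
  rrb_act :: "'g \<Rightarrow> 'h \<Rightarrow> 'h"
  rrb_op :: "'h \<Rightarrow> 'g"

definition rrb_group :: "('h, 'g) rrb \<Rightarrow> bool" where
  "rrb_group X \<longleftrightarrow>
     group (rrbH X) \<and> group (rrbG X) \<and>
     rrb_act X \<in> hom (rrbG X) (AutoGroup (rrbH X)) \<and>
     rrb_op X \<in> carrier (rrbH X) \<rightarrow> carrier (rrbG X) \<and>
     (\<forall>h1\<in>carrier (rrbH X). \<forall>h2\<in>carrier (rrbH X).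
        rrb_op X h1 \<otimes>\<^bsub>rrbG X\<^esub> rrb_op X h2
        = rrb_op X (h1 \<otimes>\<^bsub>rrbH X\<^esub> rrb_act X (rrb_op X h1) h2))"

definition rrb_trivial :: "('h, 'g) rrb \<Rightarrow> bool" where
  "rrb_trivial X \<longleftrightarrow>
     rrb_group X \<and> (\<forall>g\<in>carrier (rrbG X). rrb_act X g = \<one>\<^bsub>AutoGroup (rrbH X)\<^esub>)"

definition rrb_hom :: "('h, 'g) rrb \<Rightarrow> ('k, 'l) rrb \<Rightarrow> (('h \<Rightarrow> 'k) \<times> ('g \<Rightarrow> 'l)) set" where
  "rrb_hom X Y = {(\<psi>, \<eta>).
     \<psi> \<in> hom (rrbH X) (rrbH Y) \<and> \<eta> \<in> hom (rrbG X) (rrbG Y) \<and>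
     (\<forall>h\<in>carrier (rrbH X). \<eta> (rrb_op X h) = rrb_op Y (\<psi> h)) \<and>
     (\<forall>g\<in>carrier (rrbG X). \<forall>h\<in>carrier (rrbH X).
        \<psi> (rrb_act X g h) = rrb_act Y (\<eta> g) (\<psi> h))}"

definition rrb_iso :: "('h, 'g) rrb \<Rightarrow> ('k, 'l) rrb \<Rightarrow> (('h \<Rightarrow> 'k) \<times> ('g \<Rightarrow> 'l)) set" where
  "rrb_iso X Y = {(\<psi>, \<eta>) \<in> rrb_hom X Y.
     \<psi> \<in> iso (rrbH X) (rrbH Y) \<and> \<eta> \<in> iso (rrbG X) (rrbG Y)}"

text \<open>As in \<^const>\<open>AutoGroup\<close>, automorphisms are extensional functions, so that two of
  them are equal iff they agree on the carriers.\<close>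

definition rrb_Aut :: "('h, 'g) rrb \<Rightarrow> (('h \<Rightarrow> 'h) \<times> ('g \<Rightarrow> 'g)) monoid" where
  "rrb_Aut X = (AutoGroup (rrbH X) \<times>\<times> AutoGroup (rrbG X))
     \<lparr>carrier := rrb_iso X X \<inter> (auto (rrbH X) \<times> auto (rrbG X))\<rparr>"


section \<open>Extensions\<close>

text \<open>The embedding \<open>(i\<^sub>1, i\<^sub>2)\<close> of the kernel is kept explicit:
  nothing below requires the kernel to be a literal subset of the middle term.\<close>

record ('k, 'l, 'h, 'g, 'a, 'b) rrb_ext =
  mid :: "('h, 'g) rrb"
  inc1 :: "'k \<Rightarrow> 'h"
  inc2 :: "'l \<Rightarrow> 'g"
  proj1 :: "'h \<Rightarrow> 'a"
  proj2 :: "'g \<Rightarrow> 'b"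

definition rrb_extension ::
  "('a, 'b) rrb \<Rightarrow> ('k, 'l) rrb \<Rightarrow> ('k, 'l, 'h, 'g, 'a, 'b) rrb_ext \<Rightarrow> bool" where
  "rrb_extension \<A> \<K> E \<longleftrightarrow>
     rrb_group \<A> \<and> rrb_group \<K> \<and> rrb_group (mid E) \<and>
     (inc1 E, inc2 E) \<in> rrb_hom \<K> (mid E) \<and>
     (proj1 E, proj2 E) \<in> rrb_hom (mid E) \<A> \<and>
     inj_on (inc1 E) (carrier (rrbH \<K>)) \<and>
     inj_on (inc2 E) (carrier (rrbG \<K>)) \<and>
     proj1 E ` carrier (rrbH (mid E)) = carrier (rrbH \<A>) \<and>
     proj2 E ` carrier (rrbG (mid E)) = carrier (rrbG \<A>) \<and>
     inc1 E ` carrier (rrbH \<K>) = kernel (rrbH (mid E)) (rrbH \<A>) (proj1 E) \<and>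
     inc2 E ` carrier (rrbG \<K>) = kernel (rrbG (mid E)) (rrbG \<A>) (proj2 E)"

definition rrb_abelian_extension ::
  "('a, 'b) rrb \<Rightarrow> ('k, 'l) rrb \<Rightarrow> ('k, 'l, 'h, 'g, 'a, 'b) rrb_ext \<Rightarrow> bool" where
  "rrb_abelian_extension \<A> \<K> E \<longleftrightarrow>
     rrb_extension \<A> \<K> E \<and>
     comm_group (rrbH \<K>) \<and> comm_group (rrbG \<K>) \<and> rrb_trivial \<K>"

definition rrb_ext_equiv ::
  "('a, 'b) rrb \<Rightarrow> ('k, 'l) rrb \<Rightarrow> ('k, 'l, 'h, 'g, 'a, 'b) rrb_ext \<Rightarrow>
   ('k, 'l, 'h, 'g, 'a, 'b) rrb_ext \<Rightarrow> bool" where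
  "rrb_ext_equiv \<A> \<K> E E' \<longleftrightarrow>
     rrb_extension \<A> \<K> E \<and> rrb_extension \<A> \<K> E' \<and>
     (\<exists>(\<psi>, \<eta>) \<in> rrb_iso (mid E) (mid E').
        (\<forall>k\<in>carrier (rrbH \<K>). \<psi> (inc1 E k) = inc1 E' k) \<and>
        (\<forall>l\<in>carrier (rrbG \<K>). \<eta> (inc2 E l) = inc2 E' l) \<and>
        (\<forall>h\<in>carrier (rrbH (mid E)). proj1 E' (\<psi> h) = proj1 E h) \<and>
        (\<forall>g\<in>carrier (rrbG (mid E)). proj2 E' (\<eta> g) = proj2 E g))"

definition rrb_ext_class ::
  "('a, 'b) rrb \<Rightarrow> ('k, 'l) rrb \<Rightarrow> ('k, 'l, 'h, 'g, 'a, 'b) rrb_ext \<Rightarrow>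
   ('k, 'l, 'h, 'g, 'a, 'b) rrb_ext set" where
  "rrb_ext_class \<A> \<K> E = {E'. rrb_ext_equiv \<A> \<K> E E'}"

definition rrb_sections ::
  "('a, 'b) rrb \<Rightarrow> ('k, 'l, 'h, 'g, 'a, 'b) rrb_ext \<Rightarrow> (('a \<Rightarrow> 'h) \<times> ('b \<Rightarrow> 'g)) set" where
  "rrb_sections \<A> E = {(sH, sG).
     sH \<in> carrier (rrbH \<A>) \<rightarrow> carrier (rrbH (mid E)) \<and>
     sG \<in> carrier (rrbG \<A>) \<rightarrow> carrier (rrbG (mid E)) \<and>
     (\<forall>a\<in>carrier (rrbH \<A>). proj1 E (sH a) = a) \<and>
     (\<forall>b\<in>carrier (rrbG \<A>). proj2 E (sG b) = b) \<and>
     sH \<one>\<^bsub>rrbH \<A>\<^esub> = \<one>\<^bsub>rrbH (mid E)\<^esub> \<and>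
     sG \<one>\<^bsub>rrbG \<A>\<^esub> = \<one>\<^bsub>rrbG (mid E)\<^esub>}"

text \<open>\<open>(\<nu>, \<mu>, \<sigma>, f)\<close> is the action associated with an abelian extension \<open>E\<close>.
  The formulas are equations in the middle term; they do not depend on the sections, so it does
  not matter which pair of sections is used.\<close>

definition rrb_assoc_action ::
  "('a, 'b) rrb \<Rightarrow> ('k, 'l) rrb \<Rightarrow> ('k, 'l, 'h, 'g, 'a, 'b) rrb_ext \<Rightarrow>
   ('b \<Rightarrow> 'k \<Rightarrow> 'k) \<Rightarrow> ('a \<Rightarrow> 'k \<Rightarrow> 'k) \<Rightarrow> ('b \<Rightarrow> 'l \<Rightarrow> 'l) \<Rightarrow> ('l \<Rightarrow> 'a \<Rightarrow> 'k) \<Rightarrow> bool" where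
  "rrb_assoc_action \<A> \<K> E \<nu> \<mu> \<sigma> f \<longleftrightarrow>
     \<nu> \<in> carrier (rrbG \<A>) \<rightarrow> auto (rrbH \<K>) \<and>
     \<mu> \<in> carrier (rrbH \<A>) \<rightarrow> auto (rrbH \<K>) \<and>
     \<sigma> \<in> carrier (rrbG \<A>) \<rightarrow> auto (rrbG \<K>) \<and>
     f \<in> carrier (rrbG \<K>) \<rightarrow> carrier (rrbH \<A>) \<rightarrow> carrier (rrbH \<K>) \<and>
     (\<exists>(sH, sG) \<in> rrb_sections \<A> E.
        (\<forall>b\<in>carrier (rrbG \<A>). \<forall>k\<in>carrier (rrbH \<K>).
           inc1 E (\<nu> b k) = rrb_act (mid E) (sG b) (inc1 E k)) \<and>
        (\<forall>a\<in>carrier (rrbH \<A>). \<forall>k\<in>carrier (rrbH \<K>).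
           inc1 E (\<mu> a k)
           = inv\<^bsub>rrbH (mid E)\<^esub> sH a \<otimes>\<^bsub>rrbH (mid E)\<^esub> inc1 E k \<otimes>\<^bsub>rrbH (mid E)\<^esub> sH a) \<and>
        (\<forall>b\<in>carrier (rrbG \<A>). \<forall>l\<in>carrier (rrbG \<K>).
           inc2 E (\<sigma> b l)
           = inv\<^bsub>rrbG (mid E)\<^esub> sG b \<otimes>\<^bsub>rrbG (mid E)\<^esub> inc2 E l \<otimes>\<^bsub>rrbG (mid E)\<^esub> sG b) \<and>
        (\<forall>l\<in>carrier (rrbG \<K>). \<forall>a\<in>carrier (rrbH \<A>).
           inc1 E (f l a)
           = inv\<^bsub>rrbH (mid E)\<^esub> sH a \<otimes>\<^bsub>rrbH (mid E)\<^esub> rrb_act (mid E) (inc2 E l) (sH a)))"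

text \<open>Classes of abelian extensions whose middle term lives on fixed types \<open>'h\<close> and \<open>'g\<close>.\<close>

definition rrb_Ext ::
  "('a, 'b) rrb \<Rightarrow> ('k, 'l) rrb \<Rightarrow>
   ('b \<Rightarrow> 'k \<Rightarrow> 'k) \<Rightarrow> ('a \<Rightarrow> 'k \<Rightarrow> 'k) \<Rightarrow> ('b \<Rightarrow> 'l \<Rightarrow> 'l) \<Rightarrow> ('l \<Rightarrow> 'a \<Rightarrow> 'k) \<Rightarrow>
   ('k, 'l, 'h, 'g, 'a, 'b) rrb_ext set set" where
  "rrb_Ext \<A> \<K> \<nu> \<mu> \<sigma> f =
     {rrb_ext_class \<A> \<K> E | E.
        rrb_abelian_extension \<A> \<K> E \<and> rrb_assoc_action \<A> \<K> E \<nu> \<mu> \<sigma> f}"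


section \<open>Derivations\<close>

text \<open>Cochains are extensional functions, so that equality of pairs is equality on the carriers.\<close>

definition Z1_RRB ::
  "('a, 'b) rrb \<Rightarrow> ('k, 'l) rrb \<Rightarrow>
   ('b \<Rightarrow> 'k \<Rightarrow> 'k) \<Rightarrow> ('a \<Rightarrow> 'k \<Rightarrow> 'k) \<Rightarrow> ('b \<Rightarrow> 'l \<Rightarrow> 'l) \<Rightarrow> ('l \<Rightarrow> 'a \<Rightarrow> 'k) \<Rightarrow>
   (('a \<Rightarrow> 'k) \<times> ('b \<Rightarrow> 'l)) monoid" where
  "Z1_RRB \<A> \<K> \<nu> \<mu> \<sigma> f =
     \<lparr>carrier = {(\<kappa>1, \<kappa>2).
        \<kappa>1 \<in> carrier (rrbH \<A>) \<rightarrow>\<^sub>E carrier (rrbH \<K>) \<and>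
        \<kappa>2 \<in> carrier (rrbG \<A>) \<rightarrow>\<^sub>E carrier (rrbG \<K>) \<and>
        \<kappa>1 \<one>\<^bsub>rrbH \<A>\<^esub> = \<one>\<^bsub>rrbH \<K>\<^esub> \<and> \<kappa>2 \<one>\<^bsub>rrbG \<A>\<^esub> = \<one>\<^bsub>rrbG \<K>\<^esub> \<and>
        (\<forall>a1\<in>carrier (rrbH \<A>). \<forall>a2\<in>carrier (rrbH \<A>).
           \<kappa>1 (a1 \<otimes>\<^bsub>rrbH \<A>\<^esub> a2) = \<kappa>1 a2 \<otimes>\<^bsub>rrbH \<K>\<^esub> \<mu> a2 (\<kappa>1 a1)) \<and>
        (\<forall>b1\<in>carrier (rrbG \<A>). \<forall>b2\<in>carrier (rrbG \<A>).
           \<kappa>2 (b1 \<otimes>\<^bsub>rrbG \<A>\<^esub> b2) = \<kappa>2 b2 \<otimes>\<^bsub>rrbG \<K>\<^esub> \<sigma> b2 (\<kappa>2 b1)) \<and>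
        (\<forall>a\<in>carrier (rrbH \<A>). \<forall>b\<in>carrier (rrbG \<A>).
           \<nu> b (f (\<kappa>2 b) a \<otimes>\<^bsub>rrbH \<K>\<^esub> \<kappa>1 a) = \<kappa>1 (rrb_act \<A> b a)) \<and>
        (\<forall>a\<in>carrier (rrbH \<A>).
           rrb_op \<K> ((inv\<^bsub>AutoGroup (rrbH \<K>)\<^esub> \<nu> (rrb_op \<A> a)) (\<kappa>1 a)) = \<kappa>2 (rrb_op \<A> a))},
      mult = (\<lambda>(\<kappa>1, \<kappa>2) (\<kappa>1', \<kappa>2').
        (\<lambda>a\<in>carrier (rrbH \<A>). \<kappa>1 a \<otimes>\<^bsub>rrbH \<K>\<^esub> \<kappa>1' a,
         \<lambda>b\<in>carrier (rrbG \<A>). \<kappa>2 b \<otimes>\<^bsub>rrbG \<K>\<^esub> \<kappa>2' b)),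
      one = (\<lambda>a\<in>carrier (rrbH \<A>). \<one>\<^bsub>rrbH \<K>\<^esub>, \<lambda>b\<in>carrier (rrbG \<A>). \<one>\<^bsub>rrbG \<K>\<^esub>)\<rparr>"


section \<open>Automorphism groups of an extension\<close>

definition rrb_Aut_norm ::
  "('k, 'l) rrb \<Rightarrow> ('k, 'l, 'h, 'g, 'a, 'b) rrb_ext \<Rightarrow> (('h \<Rightarrow> 'h) \<times> ('g \<Rightarrow> 'g)) monoid" where
  "rrb_Aut_norm \<K> E = (rrb_Aut (mid E))
     \<lparr>carrier := {\<gamma> \<in> carrier (rrb_Aut (mid E)).
        fst \<gamma> ` inc1 E ` carrier (rrbH \<K>) = inc1 E ` carrier (rrbH \<K>) \<and>
        snd \<gamma> ` inc2 E ` carrier (rrbG \<K>) = inc2 E ` carrier (rrbG \<K>)}\<rparr>"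

text \<open>The restriction \<open>\<gamma>\<^sub>\<K>\<close>, transported back along the embedding.\<close>

definition rrb_restr ::
  "('k, 'l) rrb \<Rightarrow> ('k, 'l, 'h, 'g, 'a, 'b) rrb_ext \<Rightarrow> ('h \<Rightarrow> 'h) \<times> ('g \<Rightarrow> 'g) \<Rightarrow>
   ('k \<Rightarrow> 'k) \<times> ('l \<Rightarrow> 'l)" where
  "rrb_restr \<K> E \<gamma> =
     (\<lambda>k\<in>carrier (rrbH \<K>). inv_into (carrier (rrbH \<K>)) (inc1 E) (fst \<gamma> (inc1 E k)),
      \<lambda>l\<in>carrier (rrbG \<K>). inv_into (carrier (rrbG \<K>)) (inc2 E) (snd \<gamma> (inc2 E l)))"

text \<open>The induced map \<open>\<gamma>\<^sub>\<A>\<close>, computed with sections \<open>(sH, sG)\<close>.\<close>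

definition rrb_induced ::
  "('a, 'b) rrb \<Rightarrow> ('k, 'l, 'h, 'g, 'a, 'b) rrb_ext \<Rightarrow> ('a \<Rightarrow> 'h) \<times> ('b \<Rightarrow> 'g) \<Rightarrow>
   ('h \<Rightarrow> 'h) \<times> ('g \<Rightarrow> 'g) \<Rightarrow> ('a \<Rightarrow> 'a) \<times> ('b \<Rightarrow> 'b)" where
  "rrb_induced \<A> E s \<gamma> =
     (\<lambda>a\<in>carrier (rrbH \<A>). proj1 E (fst \<gamma> (fst s a)),
      \<lambda>b\<in>carrier (rrbG \<A>). proj2 E (snd \<gamma> (snd s b)))"

text \<open>The group \<open>Aut\<^sup>\<A>\<^sup>,\<^sup>\<K>(\<H>)\<close>. For \<open>\<gamma>\<close> in \<^const>\<open>rrb_Aut_norm\<close> the induced map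
  is the same for all sections, so it does not matter which pair is used.\<close>

definition rrb_Aut_fix ::
  "('a, 'b) rrb \<Rightarrow> ('k, 'l) rrb \<Rightarrow> ('k, 'l, 'h, 'g, 'a, 'b) rrb_ext \<Rightarrow>
   (('h \<Rightarrow> 'h) \<times> ('g \<Rightarrow> 'g)) monoid" where
  "rrb_Aut_fix \<A> \<K> E = (rrb_Aut_norm \<K> E)
     \<lparr>carrier := {\<gamma> \<in> carrier (rrb_Aut_norm \<K> E).
        rrb_restr \<K> E \<gamma> = \<one>\<^bsub>rrb_Aut \<K>\<^esub> \<and>
        (\<exists>s\<in>rrb_sections \<A> E. rrb_induced \<A> E s \<gamma> = \<one>\<^bsub>rrb_Aut \<A>\<^esub>)}\<rparr>"

end

theory Submission
  imports Defs
begin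

text \<open>
  An automorphism \<open>\<gamma>\<close> of a group extension of \<open>A\<close> by an abelian group \<open>K\<close> that is the identity on
  both \<open>K\<close> and \<open>A\<close> has the form \<open>\<gamma> h = h \<kappa>(p h)\<close> for a unique map \<open>\<kappa>\<close> from \<open>A\<close> to \<open>K\<close>, and \<open>\<gamma>\<close> is
  multiplicative iff \<open>\<kappa>\<close> is a derivation; composition of automorphisms becomes the pointwise
  product because \<open>K\<close> is abelian. For a pair of such automorphisms, compatibility with \<open>\<phi>\<close> and \<open>R\<close>
  translates into the last two cocycle conditions, by
  \<open>\<phi>\<^bsub>g l\<^esub>(h k) = \<phi>\<^bsub>g\<^esub>(h) \<nu>(f(l, h) k)\<close> and \<open>R(h k) = R(h) S(\<nu>\<^sup>-\<^sup>1 k)\<close>. That the cocycles form a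
  group is obtained by transport of structure from the automorphisms.
\<close>

section \<open>Automorphisms of groups\<close>

lemma AutoGroup_mult:
  "\<lbrakk>g \<in> auto G; h \<in> auto G\<rbrakk> \<Longrightarrow> g \<otimes>\<^bsub>AutoGroup G\<^esub> h = compose (carrier G) g h"
  by (simp add: AutoGroup_def BijGroup_def auto_def)

lemma AutoGroup_one: "\<one>\<^bsub>AutoGroup G\<^esub> = (\<lambda>x\<in>carrier G. x)"
  by (simp add: AutoGroup_def BijGroup_def)

lemma carrier_AutoGroup: "carrier (AutoGroup G) = auto G"
  by (simp add: AutoGroup_def)

lemma auto_closed: "\<lbrakk>g \<in> auto G; x \<in> carrier G\<rbrakk> \<Longrightarrow> g x \<in> carrier G"
  by (auto simp: auto_def hom_def)

lemma auto_mult: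
  "\<lbrakk>g \<in> auto G; x \<in> carrier G; y \<in> carrier G\<rbrakk> \<Longrightarrow> g (x \<otimes>\<^bsub>G\<^esub> y) = g x \<otimes>\<^bsub>G\<^esub> g y"
  by (auto simp: auto_def hom_def)

lemma auto_extensional: "g \<in> auto G \<Longrightarrow> g \<in> extensional (carrier G)"
  by (auto simp: auto_def Bij_def)

lemma (in group) inv_auto: "g \<in> auto G \<Longrightarrow> inv\<^bsub>AutoGroup G\<^esub> g \<in> auto G"
  using group.inv_closed[OF AutoGroup] by (simp add: carrier_AutoGroup)

lemma (in group) auto_inv_apply:
  assumes "g \<in> auto G" "x \<in> carrier G"
  shows "g ((inv\<^bsub>AutoGroup G\<^esub> g) x) = x" "(inv\<^bsub>AutoGroup G\<^esub> g) (g x) = x"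
proof -
  interpret AG: group "AutoGroup G" by (rule AutoGroup)
  have g: "g \<in> carrier (AutoGroup G)" using assms by (simp add: carrier_AutoGroup)
  have "compose (carrier G) g (inv\<^bsub>AutoGroup G\<^esub> g) = (\<lambda>x\<in>carrier G. x)"
    using AG.r_inv[OF g] assms(1) by (simp add: AutoGroup_mult inv_auto AutoGroup_one)
  then show "g ((inv\<^bsub>AutoGroup G\<^esub> g) x) = x"
    using assms(2) by (metis compose_eq restrict_apply')
  have "compose (carrier G) (inv\<^bsub>AutoGroup G\<^esub> g) g = (\<lambda>x\<in>carrier G. x)"
    using AG.l_inv[OF g] assms(1) by (simp add: AutoGroup_mult inv_auto AutoGroup_one)
  then show "(inv\<^bsub>AutoGroup G\<^esub> g) (g x) = x"
    using assms(2) by (metis compose_eq restrict_apply')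
qed

lemma hom_AutoGroup_auto: "\<lbrakk>a \<in> hom G (AutoGroup H); g \<in> carrier G\<rbrakk> \<Longrightarrow> a g \<in> auto H"
  by (auto simp: hom_def carrier_AutoGroup)

lemma hom_AutoGroup_mult_apply:
  assumes "a \<in> hom G (AutoGroup H)" "g \<in> carrier G" "g' \<in> carrier G" "x \<in> carrier H"
  shows "a (g \<otimes>\<^bsub>G\<^esub> g') x = a g (a g' x)"
  using assms hom_mult[OF assms(1-3)]
  by (simp add: AutoGroup_mult hom_AutoGroup_auto[OF assms(1)] compose_eq)

section \<open>Group extensions with abelian kernel\<close>

locale abelian_kernel = K: comm_group K + H: group H + A: group A
  for K :: "'k monoid" and H :: "'h monoid" and A :: "'a monoid" +
  fixes i :: "'k \<Rightarrow> 'h" and p :: "'h \<Rightarrow> 'a"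
  assumes i_hom: "i \<in> hom K H"
    and i_inj: "inj_on i (carrier K)"
    and p_hom: "p \<in> hom H A"
    and p_surj: "p ` carrier H = carrier A"
    and exact: "i ` carrier K = kernel H A p"
begin

sublocale i: group_hom K H i
  by unfold_locales (rule i_hom)

sublocale p: group_hom H A p
  by unfold_locales (rule p_hom)

lemma p_i [simp]: "k \<in> carrier K \<Longrightarrow> p (i k) = \<one>\<^bsub>A\<^esub>"
  using exact by (auto simp: kernel_def)

lemma i_eq_iff [simp]: "\<lbrakk>k \<in> carrier K; k' \<in> carrier K\<rbrakk> \<Longrightarrow> i k = i k' \<longleftrightarrow> k = k'"
  using i_inj by (auto simp: inj_on_def)

lemma obtain_lift:
  assumes "a \<in> carrier A"
  obtains h where "h \<in> carrier H" "p h = a"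
  using assms p_surj by (metis imageE)

lemma same_fibre:
  assumes "x \<in> carrier H" "y \<in> carrier H" "p x = p y"
  obtains k where "k \<in> carrier K" "y = x \<otimes>\<^bsub>H\<^esub> i k"
proof -
  have "inv\<^bsub>H\<^esub> x \<otimes>\<^bsub>H\<^esub> y \<in> kernel H A p"
    using assms by (simp add: kernel_def)
  then obtain k where "k \<in> carrier K" "i k = inv\<^bsub>H\<^esub> x \<otimes>\<^bsub>H\<^esub> y"
    using exact by (metis imageE)
  moreover have "y = x \<otimes>\<^bsub>H\<^esub> (inv\<^bsub>H\<^esub> x \<otimes>\<^bsub>H\<^esub> y)"
    using assms by (simp flip: H.m_assoc)
  ultimately show ?thesis using that by simp
qed

lemma conj_fibre:
  assumes "x \<in> carrier H" "y \<in> carrier H" "p x = p y" "k \<in> carrier K"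
  shows "inv\<^bsub>H\<^esub> x \<otimes>\<^bsub>H\<^esub> i k \<otimes>\<^bsub>H\<^esub> x = inv\<^bsub>H\<^esub> y \<otimes>\<^bsub>H\<^esub> i k \<otimes>\<^bsub>H\<^esub> y"
proof -
  obtain j where j: "j \<in> carrier K" "y = x \<otimes>\<^bsub>H\<^esub> i j"
    using assms(1-3) by (rule same_fibre)
  have "inv\<^bsub>H\<^esub> x \<otimes>\<^bsub>H\<^esub> i k \<otimes>\<^bsub>H\<^esub> x \<in> kernel H A p"
    using assms by (simp add: kernel_def)
  then obtain m where m: "m \<in> carrier K" "inv\<^bsub>H\<^esub> x \<otimes>\<^bsub>H\<^esub> i k \<otimes>\<^bsub>H\<^esub> x = i m"
    unfolding exact[symmetric] by (rule imageE) simp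
  have "inv\<^bsub>H\<^esub> y \<otimes>\<^bsub>H\<^esub> i k \<otimes>\<^bsub>H\<^esub> y = inv\<^bsub>H\<^esub> i j \<otimes>\<^bsub>H\<^esub> (inv\<^bsub>H\<^esub> x \<otimes>\<^bsub>H\<^esub> i k \<otimes>\<^bsub>H\<^esub> x) \<otimes>\<^bsub>H\<^esub> i j"
    using assms(1,4) j by (simp add: H.inv_mult_group H.m_assoc)
  also have "\<dots> = inv\<^bsub>H\<^esub> i j \<otimes>\<^bsub>H\<^esub> i (m \<otimes>\<^bsub>K\<^esub> j)"
    using m j by (simp add: H.m_assoc)
  also have "\<dots> = inv\<^bsub>H\<^esub> i j \<otimes>\<^bsub>H\<^esub> i (j \<otimes>\<^bsub>K\<^esub> m)"
    using m(1) j(1) by (simp only: K.m_comm)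
  also have "\<dots> = i m"
    using m(1) j(1) by (simp add: H.m_assoc[symmetric])
  finally show ?thesis using m(2) by simp
qed

lemma restriction_id_iff:
  assumes "\<gamma> ` i ` carrier K = i ` carrier K"
  shows "(\<lambda>k\<in>carrier K. inv_into (carrier K) i (\<gamma> (i k))) = (\<lambda>k\<in>carrier K. k)
    \<longleftrightarrow> (\<forall>k\<in>carrier K. \<gamma> (i k) = i k)" (is "?l = ?r \<longleftrightarrow> _")
proof
  assume eq: "?l = ?r"
  show "\<forall>k\<in>carrier K. \<gamma> (i k) = i k"
  proof
    fix k assume k: "k \<in> carrier K"
    then have "\<gamma> (i k) \<in> i ` carrier K" using assms by blast
    then have "i (inv_into (carrier K) i (\<gamma> (i k))) = \<gamma> (i k)" by (rule f_inv_into_f)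
    then show "\<gamma> (i k) = i k" using fun_cong[OF eq, of k] k by simp
  qed
qed (auto simp: inv_into_f_f[OF i_inj])

lemma induced_id_iff:
  assumes \<gamma>: "\<gamma> \<in> auto H" "\<And>k. k \<in> carrier K \<Longrightarrow> \<gamma> (i k) = i k"
    and s: "\<And>a. a \<in> carrier A \<Longrightarrow> s a \<in> carrier H" "\<And>a. a \<in> carrier A \<Longrightarrow> p (s a) = a"
  shows "(\<lambda>a\<in>carrier A. p (\<gamma> (s a))) = (\<lambda>a\<in>carrier A. a)
    \<longleftrightarrow> (\<forall>h\<in>carrier H. p (\<gamma> h) = p h)" (is "?l = ?r \<longleftrightarrow> _")
proof
  assume eq: "?l = ?r"
  show "\<forall>h\<in>carrier H. p (\<gamma> h) = p h"
  proof
    fix h assume h: "h \<in> carrier H"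
    define t where "t = s (p h)"
    have t: "t \<in> carrier H" "p t = p h" "p (\<gamma> t) = p h"
      using h s[of "p h"] fun_cong[OF eq, of "p h"] by (simp_all add: t_def)
    obtain k where k: "k \<in> carrier K" "h = t \<otimes>\<^bsub>H\<^esub> i k"
      using t(1) h t(2) by (rule same_fibre)
    then show "p (\<gamma> h) = p h"
      using t by (simp add: auto_mult[OF \<gamma>(1)] \<gamma>(2) auto_closed[OF \<gamma>(1)])
  qed
qed (auto simp: s)

end

locale abelian_extension = abelian_kernel K H A i p
  for K :: "'k monoid" and H :: "'h monoid" and A :: "'a monoid"
    and i :: "'k \<Rightarrow> 'h" and p :: "'h \<Rightarrow> 'a" +
  fixes \<mu> :: "'a \<Rightarrow> 'k \<Rightarrow> 'k"
  assumes \<mu>_auto: "\<mu> \<in> carrier A \<rightarrow> auto K"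
    and conj: "\<lbrakk>h \<in> carrier H; k \<in> carrier K\<rbrakk> \<Longrightarrow>
      i (\<mu> (p h) k) = inv\<^bsub>H\<^esub> h \<otimes>\<^bsub>H\<^esub> i k \<otimes>\<^bsub>H\<^esub> h"
begin

lemma \<mu>_closed [simp]: "\<lbrakk>a \<in> carrier A; k \<in> carrier K\<rbrakk> \<Longrightarrow> \<mu> a k \<in> carrier K"
  by (rule auto_closed[OF funcset_mem[OF \<mu>_auto]])

lemma i_commute:
  assumes "h \<in> carrier H" "k \<in> carrier K"
  shows "i k \<otimes>\<^bsub>H\<^esub> h = h \<otimes>\<^bsub>H\<^esub> i (\<mu> (p h) k)"
  using assms by (simp add: conj H.m_assoc[symmetric])

definition twist :: "('a \<Rightarrow> 'k) \<Rightarrow> 'h \<Rightarrow> 'h" where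
  "twist \<kappa> = (\<lambda>h\<in>carrier H. h \<otimes>\<^bsub>H\<^esub> i (\<kappa> (p h)))"

definition Der :: "('a \<Rightarrow> 'k) set" where
  "Der = {\<kappa> \<in> carrier A \<rightarrow>\<^sub>E carrier K. \<kappa> \<one>\<^bsub>A\<^esub> = \<one>\<^bsub>K\<^esub> \<and>
     (\<forall>a1\<in>carrier A. \<forall>a2\<in>carrier A.
        \<kappa> (a1 \<otimes>\<^bsub>A\<^esub> a2) = \<kappa> a2 \<otimes>\<^bsub>K\<^esub> \<mu> a2 (\<kappa> a1))}"

definition Stab :: "('h \<Rightarrow> 'h) set" where
  "Stab = {\<gamma> \<in> auto H. (\<forall>k\<in>carrier K. \<gamma> (i k) = i k) \<and> (\<forall>h\<in>carrier H. p (\<gamma> h) = p h)}"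

lemma twist_closed [simp]:
  "\<lbrakk>\<kappa> \<in> carrier A \<rightarrow> carrier K; h \<in> carrier H\<rbrakk> \<Longrightarrow> twist \<kappa> h \<in> carrier H"
  using p.hom_closed[of h] by (auto simp: twist_def Pi_iff)

lemma p_twist [simp]:
  assumes "\<kappa> \<in> carrier A \<rightarrow> carrier K" "h \<in> carrier H"
  shows "p (twist \<kappa> h) = p h"
proof -
  have "\<kappa> (p h) \<in> carrier K" using assms by auto
  then show ?thesis using assms by (simp add: twist_def)
qed

lemma inj_on_twist: "inj_on twist (carrier A \<rightarrow>\<^sub>E carrier K)"
proof (rule inj_onI)
  fix \<kappa> \<rho>
  assume \<kappa>: "\<kappa> \<in> carrier A \<rightarrow>\<^sub>E carrier K" and \<rho>: "\<rho> \<in> carrier A \<rightarrow>\<^sub>E carrier K"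
    and eq: "twist \<kappa> = twist \<rho>"
  show "\<kappa> = \<rho>"
  proof (rule PiE_ext[OF \<kappa> \<rho>])
    fix a assume a: "a \<in> carrier A"
    then obtain h where h: "h \<in> carrier H" "p h = a" by (rule obtain_lift)
    have k: "\<kappa> a \<in> carrier K" "\<rho> a \<in> carrier K" using \<kappa> \<rho> a by auto
    have "h \<otimes>\<^bsub>H\<^esub> i (\<kappa> a) = h \<otimes>\<^bsub>H\<^esub> i (\<rho> a)"
      using fun_cong[OF eq, of h] h by (simp add: twist_def)
    then show "\<kappa> a = \<rho> a" using h k by simp
  qed
qed

lemma twist_one: "twist (\<lambda>a\<in>carrier A. \<one>\<^bsub>K\<^esub>) = (\<lambda>h\<in>carrier H. h)"
  by (auto simp: twist_def)

lemma twist_mult: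
  assumes "\<kappa> \<in> carrier A \<rightarrow> carrier K" "\<rho> \<in> carrier A \<rightarrow> carrier K"
  shows "twist (\<lambda>a\<in>carrier A. \<kappa> a \<otimes>\<^bsub>K\<^esub> \<rho> a) = compose (carrier H) (twist \<kappa>) (twist \<rho>)"
proof
  fix h
  show "twist (\<lambda>a\<in>carrier A. \<kappa> a \<otimes>\<^bsub>K\<^esub> \<rho> a) h = compose (carrier H) (twist \<kappa>) (twist \<rho>) h"
  proof (cases "h \<in> carrier H")
    case True
    have k: "\<kappa> (p h) \<in> carrier K" "\<rho> (p h) \<in> carrier K" using assms True by auto
    have "compose (carrier H) (twist \<kappa>) (twist \<rho>) h = twist \<rho> h \<otimes>\<^bsub>H\<^esub> i (\<kappa> (p h))"
      using True assms by (subst twist_def) (simp add: compose_eq)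
    also have "\<dots> = h \<otimes>\<^bsub>H\<^esub> i (\<rho> (p h) \<otimes>\<^bsub>K\<^esub> \<kappa> (p h))"
      using True k by (simp add: twist_def H.m_assoc)
    finally show ?thesis
      using True k by (simp add: twist_def K.m_comm[of "\<rho> (p h)"] del: i.hom_mult)
  qed (simp add: twist_def compose_def)
qed

lemma twist_Stab:
  assumes "\<kappa> \<in> Der"
  shows "twist \<kappa> \<in> Stab"
proof -
  have \<kappa>: "\<kappa> \<in> carrier A \<rightarrow> carrier K" and one: "\<kappa> \<one>\<^bsub>A\<^esub> = \<one>\<^bsub>K\<^esub>"
    and der: "\<And>a b. \<lbrakk>a \<in> carrier A; b \<in> carrier A\<rbrakk> \<Longrightarrow>
      \<kappa> (a \<otimes>\<^bsub>A\<^esub> b) = \<kappa> b \<otimes>\<^bsub>K\<^esub> \<mu> b (\<kappa> a)"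
    using assms by (auto simp: Der_def)
  have k: "\<kappa> (p h) \<in> carrier K" if "h \<in> carrier H" for h using \<kappa> that by auto
  have "twist \<kappa> (x \<otimes>\<^bsub>H\<^esub> y) = twist \<kappa> x \<otimes>\<^bsub>H\<^esub> twist \<kappa> y"
    if "x \<in> carrier H" "y \<in> carrier H" for x y
  proof -
    have "twist \<kappa> x \<otimes>\<^bsub>H\<^esub> twist \<kappa> y = x \<otimes>\<^bsub>H\<^esub> (i (\<kappa> (p x)) \<otimes>\<^bsub>H\<^esub> y) \<otimes>\<^bsub>H\<^esub> i (\<kappa> (p y))"
      using that k by (simp add: twist_def H.m_assoc)
    also have "\<dots> = x \<otimes>\<^bsub>H\<^esub> y \<otimes>\<^bsub>H\<^esub> i (\<mu> (p y) (\<kappa> (p x)) \<otimes>\<^bsub>K\<^esub> \<kappa> (p y))"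
      using that k by (simp add: i_commute[of y] H.m_assoc)
    finally show ?thesis
      using that k by (simp add: twist_def der K.m_comm[of "\<kappa> (p y)"] del: i.hom_mult)
  qed
  then have "twist \<kappa> \<in> hom H H" using \<kappa> by (simp add: hom_def)
  moreover have "bij_betw (twist \<kappa>) (carrier H) (carrier H)"
  proof (rule bij_betw_imageI)
    show "inj_on (twist \<kappa>) (carrier H)"
    proof (rule inj_onI)
      fix x y assume xy: "x \<in> carrier H" "y \<in> carrier H" "twist \<kappa> x = twist \<kappa> y"
      then have p: "p x = p y" using p_twist[OF \<kappa>] by metis
      have "x \<otimes>\<^bsub>H\<^esub> i (\<kappa> (p y)) = y \<otimes>\<^bsub>H\<^esub> i (\<kappa> (p y))"
        using xy(3) by (simp only: twist_def restrict_apply' xy(1,2) p)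
      then show "x = y"
        using H.right_cancel[OF i.hom_closed[OF k[OF xy(2)]] xy(1,2)] by (simp only:)
    qed
    show "twist \<kappa> ` carrier H = carrier H"
    proof (intro equalityI subsetI)
      show "y \<in> carrier H" if "y \<in> twist \<kappa> ` carrier H" for y
        using that twist_closed[OF \<kappa>] by blast
      fix y assume y: "y \<in> carrier H"
      have "y = twist \<kappa> (y \<otimes>\<^bsub>H\<^esub> inv\<^bsub>H\<^esub> i (\<kappa> (p y)))"
        using y k by (simp add: twist_def H.m_assoc)
      then show "y \<in> twist \<kappa> ` carrier H"
        by (rule image_eqI) (simp add: y k)
    qed
  qed
  moreover have "twist \<kappa> \<in> extensional (carrier H)" by (simp add: twist_def)
  ultimately have "twist \<kappa> \<in> auto H" by (simp add: auto_def Bij_def)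
  moreover have "twist \<kappa> (i k) = i k" if "k \<in> carrier K" for k
    using that one by (simp add: twist_def)
  ultimately show ?thesis using \<kappa> by (simp add: Stab_def)
qed

lemma Stab_D:
  assumes "\<gamma> \<in> Stab"
  shows "\<gamma> \<in> auto H"
    and "k \<in> carrier K \<Longrightarrow> \<gamma> (i k) = i k"
    and "h \<in> carrier H \<Longrightarrow> p (\<gamma> h) = p h"
  using assms unfolding Stab_def by blast+

lemma Stab_twist:
  assumes "\<gamma> \<in> Stab"
  obtains \<kappa> where "\<kappa> \<in> Der" "twist \<kappa> = \<gamma>"
proof -
  note \<gamma> = Stab_D(1)[OF assms] and \<gamma>i = Stab_D(2)[OF assms] and p\<gamma> = Stab_D(3)[OF assms]
  have "\<exists>k\<in>carrier K. \<forall>h\<in>carrier H. p h = a \<longrightarrow> \<gamma> h = h \<otimes>\<^bsub>H\<^esub> i k" if a: "a \<in> carrier A" for a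
  proof -
    obtain h where h: "h \<in> carrier H" "p h = a" using a by (rule obtain_lift)
    obtain k where k: "k \<in> carrier K" "\<gamma> h = h \<otimes>\<^bsub>H\<^esub> i k"
      by (rule same_fibre[OF h(1) auto_closed[OF \<gamma> h(1)] p\<gamma>[OF h(1), symmetric]])
    have "\<gamma> h' = h' \<otimes>\<^bsub>H\<^esub> i k" if h': "h' \<in> carrier H" "p h' = a" for h'
    proof -
      obtain j where j: "j \<in> carrier K" "h' = h \<otimes>\<^bsub>H\<^esub> i j"
        by (rule same_fibre[OF h(1) h'(1)]) (simp add: h h')
      have "\<gamma> h' = h \<otimes>\<^bsub>H\<^esub> i (k \<otimes>\<^bsub>K\<^esub> j)"
        using j k h by (simp add: auto_mult[OF \<gamma>] \<gamma>i H.m_assoc)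
      also have "\<dots> = h \<otimes>\<^bsub>H\<^esub> i (j \<otimes>\<^bsub>K\<^esub> k)" using j k by (simp only: K.m_comm)
      finally show ?thesis using j k h by (simp add: H.m_assoc)
    qed
    then show ?thesis using k by auto
  qed
  then obtain \<kappa>' where \<kappa>': "\<And>a. a \<in> carrier A \<Longrightarrow>
      \<kappa>' a \<in> carrier K \<and> (\<forall>h\<in>carrier H. p h = a \<longrightarrow> \<gamma> h = h \<otimes>\<^bsub>H\<^esub> i (\<kappa>' a))"
    by metis
  define \<kappa> where "\<kappa> = restrict \<kappa>' (carrier A)"
  have \<kappa>: "\<kappa> \<in> carrier A \<rightarrow>\<^sub>E carrier K" using \<kappa>' by (simp add: \<kappa>_def)
  have k [simp]: "\<kappa> a \<in> carrier K" if "a \<in> carrier A" for a using \<kappa> that by auto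
  have \<gamma>_eq: "\<gamma> h = h \<otimes>\<^bsub>H\<^esub> i (\<kappa> (p h))" if "h \<in> carrier H" for h
    using \<kappa>'[of "p h"] that by (simp add: \<kappa>_def)
  have "\<kappa> \<one>\<^bsub>A\<^esub> = \<one>\<^bsub>K\<^esub>"
  proof -
    have "i (\<kappa> \<one>\<^bsub>A\<^esub>) = \<gamma> (i \<one>\<^bsub>K\<^esub>)"
      using \<gamma>_eq[of "\<one>\<^bsub>H\<^esub>"] by simp
    also have "\<dots> = i \<one>\<^bsub>K\<^esub>" by (rule \<gamma>i) simp
    finally show ?thesis by (metis A.one_closed K.one_closed i_eq_iff k)
  qed
  moreover have "\<kappa> (a \<otimes>\<^bsub>A\<^esub> b) = \<kappa> b \<otimes>\<^bsub>K\<^esub> \<mu> b (\<kappa> a)"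
    if ab: "a \<in> carrier A" "b \<in> carrier A" for a b
  proof -
    obtain x where x: "x \<in> carrier H" "p x = a" using ab(1) by (rule obtain_lift)
    obtain y where y: "y \<in> carrier H" "p y = b" using ab(2) by (rule obtain_lift)
    have "x \<otimes>\<^bsub>H\<^esub> y \<otimes>\<^bsub>H\<^esub> i (\<kappa> (a \<otimes>\<^bsub>A\<^esub> b)) = \<gamma> x \<otimes>\<^bsub>H\<^esub> \<gamma> y"
      using \<gamma>_eq[of "x \<otimes>\<^bsub>H\<^esub> y"] x y by (simp add: auto_mult[OF \<gamma>])
    also have "\<dots> = x \<otimes>\<^bsub>H\<^esub> (i (\<kappa> a) \<otimes>\<^bsub>H\<^esub> y) \<otimes>\<^bsub>H\<^esub> i (\<kappa> b)"
      using x y ab by (simp add: \<gamma>_eq H.m_assoc)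
    also have "\<dots> = x \<otimes>\<^bsub>H\<^esub> y \<otimes>\<^bsub>H\<^esub> i (\<mu> b (\<kappa> a) \<otimes>\<^bsub>K\<^esub> \<kappa> b)"
      using x y ab by (simp add: i_commute[of y] H.m_assoc)
    finally have "i (\<kappa> (a \<otimes>\<^bsub>A\<^esub> b)) = i (\<mu> b (\<kappa> a) \<otimes>\<^bsub>K\<^esub> \<kappa> b)"
      using x y ab by (simp del: i.hom_mult i_eq_iff)
    then show ?thesis using ab by (simp add: K.m_comm[of "\<kappa> b"] del: i.hom_mult)
  qed
  ultimately have "\<kappa> \<in> Der" using \<kappa> by (simp add: Der_def)
  moreover have "twist \<kappa> = \<gamma>"
    by (rule extensionalityI[of _ "carrier H"])
      (simp_all add: auto_extensional[OF \<gamma>] \<gamma>_eq twist_def)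
  ultimately show ?thesis by (rule that)
qed

lemma subgroup_Stab: "subgroup Stab (AutoGroup H)"
proof (rule group.subgroupI[OF H.AutoGroup])
  show "Stab \<subseteq> carrier (AutoGroup H)"
    using Stab_D(1) by (simp add: carrier_AutoGroup subset_iff)
  have "(\<lambda>x\<in>carrier H. x) \<in> Stab" by (simp add: Stab_def H.id_in_auto)
  then show "Stab \<noteq> {}" by blast
next
  fix \<gamma> assume \<gamma>: "\<gamma> \<in> Stab"
  note a = Stab_D(1)[OF \<gamma>]
  show "inv\<^bsub>AutoGroup H\<^esub> \<gamma> \<in> Stab"
    unfolding Stab_def
  proof (intro CollectI conjI ballI)
    show a': "inv\<^bsub>AutoGroup H\<^esub> \<gamma> \<in> auto H" by (rule H.inv_auto[OF a])
    show "(inv\<^bsub>AutoGroup H\<^esub> \<gamma>) (i k) = i k" if "k \<in> carrier K" for k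
      using H.auto_inv_apply(2)[OF a i.hom_closed[OF that]] by (simp only: Stab_D(2)[OF \<gamma> that])
    show "p ((inv\<^bsub>AutoGroup H\<^esub> \<gamma>) h) = p h" if "h \<in> carrier H" for h
      using Stab_D(3)[OF \<gamma> auto_closed[OF a' that]]
      by (simp only: H.auto_inv_apply(1)[OF a that])
  qed
next
  fix \<gamma> \<delta> assume *: "\<gamma> \<in> Stab" "\<delta> \<in> Stab"
  note a = Stab_D(1)[OF *(1)] Stab_D(1)[OF *(2)]
  have "\<gamma> \<otimes>\<^bsub>AutoGroup H\<^esub> \<delta> \<in> auto H"
    using a group.is_monoid[OF H.AutoGroup, THEN monoid.m_closed] by (simp add: carrier_AutoGroup)
  then show "\<gamma> \<otimes>\<^bsub>AutoGroup H\<^esub> \<delta> \<in> Stab"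
    unfolding Stab_def
    using a by (simp add: AutoGroup_mult compose_eq auto_closed Stab_D[OF *(1)] Stab_D[OF *(2)])
qed

end


section \<open>Abelian extensions of relative Rota--Baxter groups\<close>

locale rrb_action_extension =
  fixes \<A> :: "('a, 'b) rrb" and \<K> :: "('k, 'l) rrb"
    and E :: "('k, 'l, 'h, 'g, 'a, 'b) rrb_ext"
    and \<nu> :: "'b \<Rightarrow> 'k \<Rightarrow> 'k" and \<mu> :: "'a \<Rightarrow> 'k \<Rightarrow> 'k"
    and \<sigma> :: "'b \<Rightarrow> 'l \<Rightarrow> 'l" and f :: "'l \<Rightarrow> 'a \<Rightarrow> 'k"
  assumes abelian: "rrb_abelian_extension \<A> \<K> E"
    and action: "rrb_assoc_action \<A> \<K> E \<nu> \<mu> \<sigma> f"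
begin

abbreviation "K \<equiv> rrbH \<K>"
abbreviation "L \<equiv> rrbG \<K>"
abbreviation "S \<equiv> rrb_op \<K>"
abbreviation "H \<equiv> rrbH (mid E)"
abbreviation "G \<equiv> rrbG (mid E)"
abbreviation "\<phi> \<equiv> rrb_act (mid E)"
abbreviation "R \<equiv> rrb_op (mid E)"
abbreviation "A \<equiv> rrbH \<A>"
abbreviation "B \<equiv> rrbG \<A>"
abbreviation "\<beta> \<equiv> rrb_act \<A>"
abbreviation "T \<equiv> rrb_op \<A>"

lemmas extension_defs = abelian[unfolded rrb_abelian_extension_def rrb_extension_def
    rrb_group_def rrb_trivial_def rrb_hom_def mem_Collect_eq prod.case]

sublocale H: abelian_kernel K H A "inc1 E" "proj1 E"
  using extension_defs
  by (intro abelian_kernel.intro abelian_kernel_axioms.intro) simp_all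

sublocale G: abelian_kernel L G B "inc2 E" "proj2 E"
  using extension_defs
  by (intro abelian_kernel.intro abelian_kernel_axioms.intro) simp_all

lemma \<phi>_hom: "\<phi> \<in> hom G (AutoGroup H)"
  and \<beta>_hom: "\<beta> \<in> hom B (AutoGroup A)"
  and R_closed: "h \<in> carrier H \<Longrightarrow> R h \<in> carrier G"
  and S_closed: "k \<in> carrier K \<Longrightarrow> S k \<in> carrier L"
  and T_closed: "a \<in> carrier A \<Longrightarrow> T a \<in> carrier B"
  and R_mult: "\<lbrakk>h \<in> carrier H; h' \<in> carrier H\<rbrakk> \<Longrightarrow> R h \<otimes>\<^bsub>G\<^esub> R h' = R (h \<otimes>\<^bsub>H\<^esub> \<phi> (R h) h')"
  and inc_op: "k \<in> carrier K \<Longrightarrow> R (inc1 E k) = inc2 E (S k)"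
  and proj_op: "h \<in> carrier H \<Longrightarrow> proj2 E (R h) = T (proj1 E h)"
  and proj_act: "\<lbrakk>g \<in> carrier G; h \<in> carrier H\<rbrakk> \<Longrightarrow> proj1 E (\<phi> g h) = \<beta> (proj2 E g) (proj1 E h)"
  using extension_defs by (simp_all add: Pi_iff)

lemma act_inc2_inc1:
  assumes "l \<in> carrier L" "k \<in> carrier K"
  shows "\<phi> (inc2 E l) (inc1 E k) = inc1 E k"
proof -
  have "inc1 E (rrb_act \<K> l k) = \<phi> (inc2 E l) (inc1 E k)"
    using extension_defs assms by blast
  moreover have "rrb_act \<K> l k = k"
    using extension_defs assms by (simp add: AutoGroup_one)
  ultimately show ?thesis by simp
qed

lemma \<phi>_auto: "g \<in> carrier G \<Longrightarrow> \<phi> g \<in> auto H"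
  by (rule hom_AutoGroup_auto[OF \<phi>_hom])

lemma \<phi>_closed [simp]: "\<lbrakk>g \<in> carrier G; h \<in> carrier H\<rbrakk> \<Longrightarrow> \<phi> g h \<in> carrier H"
  by (rule auto_closed[OF \<phi>_auto])

lemma \<nu>_auto: "b \<in> carrier B \<Longrightarrow> \<nu> b \<in> auto K"
  and \<mu>_Pi: "\<mu> \<in> carrier A \<rightarrow> auto K"
  and \<sigma>_Pi: "\<sigma> \<in> carrier B \<rightarrow> auto L"
  and f_closed [simp]: "\<lbrakk>l \<in> carrier L; a \<in> carrier A\<rbrakk> \<Longrightarrow> f l a \<in> carrier K"
  using action by (auto simp: rrb_assoc_action_def)

lemma obtain_sections:
  obtains sH sG where "(sH, sG) \<in> rrb_sections \<A> E"
    and "\<And>b k. \<lbrakk>b \<in> carrier B; k \<in> carrier K\<rbrakk> \<Longrightarrow> inc1 E (\<nu> b k) = \<phi> (sG b) (inc1 E k)"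
    and "\<And>a k. \<lbrakk>a \<in> carrier A; k \<in> carrier K\<rbrakk> \<Longrightarrow>
      inc1 E (\<mu> a k) = inv\<^bsub>H\<^esub> sH a \<otimes>\<^bsub>H\<^esub> inc1 E k \<otimes>\<^bsub>H\<^esub> sH a"
    and "\<And>b l. \<lbrakk>b \<in> carrier B; l \<in> carrier L\<rbrakk> \<Longrightarrow>
      inc2 E (\<sigma> b l) = inv\<^bsub>G\<^esub> sG b \<otimes>\<^bsub>G\<^esub> inc2 E l \<otimes>\<^bsub>G\<^esub> sG b"
    and "\<And>l a. \<lbrakk>l \<in> carrier L; a \<in> carrier A\<rbrakk> \<Longrightarrow>
      inc1 E (f l a) = inv\<^bsub>H\<^esub> sH a \<otimes>\<^bsub>H\<^esub> \<phi> (inc2 E l) (sH a)"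
  using action unfolding rrb_assoc_action_def by fast

lemma sectionsD:
  assumes "(sH, sG) \<in> rrb_sections \<A> E"
  shows "a \<in> carrier A \<Longrightarrow> sH a \<in> carrier H" "a \<in> carrier A \<Longrightarrow> proj1 E (sH a) = a"
    "b \<in> carrier B \<Longrightarrow> sG b \<in> carrier G" "b \<in> carrier B \<Longrightarrow> proj2 E (sG b) = b"
  using assms by (auto simp: rrb_sections_def)

sublocale H: abelian_extension K H A "inc1 E" "proj1 E" \<mu>
proof unfold_locales
  fix h k assume h: "h \<in> carrier H" and k: "k \<in> carrier K"
  obtain sH sG where s: "(sH, sG) \<in> rrb_sections \<A> E"
    and \<mu>: "\<And>a k. \<lbrakk>a \<in> carrier A; k \<in> carrier K\<rbrakk> \<Longrightarrow>
      inc1 E (\<mu> a k) = inv\<^bsub>H\<^esub> sH a \<otimes>\<^bsub>H\<^esub> inc1 E k \<otimes>\<^bsub>H\<^esub> sH a"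
    by (rule obtain_sections) blast
  show "inc1 E (\<mu> (proj1 E h) k) = inv\<^bsub>H\<^esub> h \<otimes>\<^bsub>H\<^esub> inc1 E k \<otimes>\<^bsub>H\<^esub> h"
    unfolding \<mu>[OF H.p.hom_closed[OF h] k]
    by (rule H.conj_fibre) (simp_all add: h k sectionsD[OF s])
qed (rule \<mu>_Pi)

sublocale G: abelian_extension L G B "inc2 E" "proj2 E" \<sigma>
proof unfold_locales
  fix g l assume g: "g \<in> carrier G" and l: "l \<in> carrier L"
  obtain sH sG where s: "(sH, sG) \<in> rrb_sections \<A> E"
    and \<sigma>: "\<And>b l. \<lbrakk>b \<in> carrier B; l \<in> carrier L\<rbrakk> \<Longrightarrow>
      inc2 E (\<sigma> b l) = inv\<^bsub>G\<^esub> sG b \<otimes>\<^bsub>G\<^esub> inc2 E l \<otimes>\<^bsub>G\<^esub> sG b"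
    by (rule obtain_sections) blast
  show "inc2 E (\<sigma> (proj2 E g) l) = inv\<^bsub>G\<^esub> g \<otimes>\<^bsub>G\<^esub> inc2 E l \<otimes>\<^bsub>G\<^esub> g"
    unfolding \<sigma>[OF G.p.hom_closed[OF g] l]
    by (rule G.conj_fibre) (simp_all add: g l sectionsD[OF s])
qed (rule \<sigma>_Pi)

lemma \<nu>_closed [simp]: "\<lbrakk>b \<in> carrier B; k \<in> carrier K\<rbrakk> \<Longrightarrow> \<nu> b k \<in> carrier K"
  by (rule auto_closed[OF \<nu>_auto])

lemma act_inc1:
  assumes g: "g \<in> carrier G" and k: "k \<in> carrier K"
  shows "\<phi> g (inc1 E k) = inc1 E (\<nu> (proj2 E g) k)"
proof -
  obtain sH sG where s: "(sH, sG) \<in> rrb_sections \<A> E"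
    and \<nu>: "\<And>b k. \<lbrakk>b \<in> carrier B; k \<in> carrier K\<rbrakk> \<Longrightarrow> inc1 E (\<nu> b k) = \<phi> (sG b) (inc1 E k)"
    by (rule obtain_sections) blast
  define t where "t = sG (proj2 E g)"
  have t: "t \<in> carrier G" "proj2 E t = proj2 E g"
    using g by (simp_all add: t_def sectionsD[OF s])
  obtain l where l: "l \<in> carrier L" "g = t \<otimes>\<^bsub>G\<^esub> inc2 E l"
    using t(1) g t(2) by (rule G.same_fibre)
  have "\<phi> g (inc1 E k) = \<phi> t (inc1 E k)"
    using l t k by (simp add: hom_AutoGroup_mult_apply[OF \<phi>_hom] act_inc2_inc1)
  then show ?thesis using \<nu>[OF G.p.hom_closed[OF g] k] by (simp add: t_def)
qed

lemma act_inc2: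
  assumes l: "l \<in> carrier L" and h: "h \<in> carrier H"
  shows "\<phi> (inc2 E l) h = h \<otimes>\<^bsub>H\<^esub> inc1 E (f l (proj1 E h))"
proof -
  obtain sH sG where s: "(sH, sG) \<in> rrb_sections \<A> E"
    and f: "\<And>l a. \<lbrakk>l \<in> carrier L; a \<in> carrier A\<rbrakk> \<Longrightarrow>
      inc1 E (f l a) = inv\<^bsub>H\<^esub> sH a \<otimes>\<^bsub>H\<^esub> \<phi> (inc2 E l) (sH a)"
    by (rule obtain_sections) blast
  define t where "t = sH (proj1 E h)"
  have t: "t \<in> carrier H" "proj1 E t = proj1 E h"
    using h by (simp_all add: t_def sectionsD[OF s])
  obtain k where k: "k \<in> carrier K" "h = t \<otimes>\<^bsub>H\<^esub> inc1 E k"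
    using t(1) h t(2) by (rule H.same_fibre)
  define m where "m = f l (proj1 E h)"
  have m: "m \<in> carrier K" using l h by (simp add: m_def)
  have "\<phi> (inc2 E l) t = t \<otimes>\<^bsub>H\<^esub> inc1 E m"
    using f[OF l H.p.hom_closed[OF h]] l t by (simp add: m_def t_def[symmetric] H.H.m_assoc[symmetric])
  then have "\<phi> (inc2 E l) h = t \<otimes>\<^bsub>H\<^esub> inc1 E (m \<otimes>\<^bsub>K\<^esub> k)"
    using l t k m by (simp add: auto_mult[OF \<phi>_auto] act_inc2_inc1 H.H.m_assoc)
  also have "\<dots> = t \<otimes>\<^bsub>H\<^esub> inc1 E (k \<otimes>\<^bsub>K\<^esub> m)" using k(1) m by (simp only: H.K.m_comm)
  finally have "\<phi> (inc2 E l) h = t \<otimes>\<^bsub>H\<^esub> inc1 E k \<otimes>\<^bsub>H\<^esub> inc1 E m"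
    using t(1) k(1) m by (simp add: H.H.m_assoc)
  then show ?thesis by (simp only: k(2)[symmetric] m_def)
qed

lemma R_mult_inc1:
  assumes h: "h \<in> carrier H" and k: "k \<in> carrier K"
  shows "R (h \<otimes>\<^bsub>H\<^esub> inc1 E k)
    = R h \<otimes>\<^bsub>G\<^esub> inc2 E (S ((inv\<^bsub>AutoGroup K\<^esub> \<nu> (T (proj1 E h))) k))"
proof -
  define b where "b = T (proj1 E h)"
  have b: "b \<in> carrier B" using h by (simp add: b_def T_closed)
  define j where "j = (inv\<^bsub>AutoGroup K\<^esub> \<nu> b) k"
  have j: "j \<in> carrier K" "\<nu> b j = k"
    using k auto_closed[OF H.K.inv_auto[OF \<nu>_auto[OF b]]] H.K.auto_inv_apply(1)[OF \<nu>_auto[OF b]]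
    by (simp_all add: j_def)
  have "R h \<otimes>\<^bsub>G\<^esub> R (inc1 E j) = R (h \<otimes>\<^bsub>H\<^esub> inc1 E k)"
    using h j by (simp add: R_mult act_inc1 R_closed proj_op b_def)
  then show ?thesis using j(1) by (simp add: inc_op j_def b_def)
qed

definition compatible :: "('h \<Rightarrow> 'h) \<Rightarrow> ('g \<Rightarrow> 'g) \<Rightarrow> bool" where
  "compatible \<gamma>1 \<gamma>2 \<longleftrightarrow> (\<forall>h\<in>carrier H. \<gamma>2 (R h) = R (\<gamma>1 h)) \<and>
     (\<forall>g\<in>carrier G. \<forall>h\<in>carrier H. \<gamma>1 (\<phi> g h) = \<phi> (\<gamma>2 g) (\<gamma>1 h))"

definition cocycle :: "('a \<Rightarrow> 'k) \<Rightarrow> ('b \<Rightarrow> 'l) \<Rightarrow> bool" where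
  "cocycle \<kappa>1 \<kappa>2 \<longleftrightarrow>
     (\<forall>a\<in>carrier A. \<forall>b\<in>carrier B. \<nu> b (f (\<kappa>2 b) a \<otimes>\<^bsub>K\<^esub> \<kappa>1 a) = \<kappa>1 (\<beta> b a)) \<and>
     (\<forall>a\<in>carrier A. S ((inv\<^bsub>AutoGroup K\<^esub> \<nu> (T a)) (\<kappa>1 a)) = \<kappa>2 (T a))"

lemma carrier_Z1: "carrier (Z1_RRB \<A> \<K> \<nu> \<mu> \<sigma> f)
    = {(\<kappa>1, \<kappa>2). \<kappa>1 \<in> H.Der \<and> \<kappa>2 \<in> G.Der \<and> cocycle \<kappa>1 \<kappa>2}"
  unfolding Z1_RRB_def H.Der_def G.Der_def cocycle_def by auto

lemma compatible_twist_iff: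
  assumes \<kappa>1: "\<kappa>1 \<in> carrier A \<rightarrow> carrier K" and \<kappa>2: "\<kappa>2 \<in> carrier B \<rightarrow> carrier L"
  shows "compatible (H.twist \<kappa>1) (G.twist \<kappa>2) \<longleftrightarrow> cocycle \<kappa>1 \<kappa>2"
proof -
  have k: "\<kappa>1 a \<in> carrier K" if "a \<in> carrier A" for a using \<kappa>1 that by auto
  have l: "\<kappa>2 b \<in> carrier L" if "b \<in> carrier B" for b using \<kappa>2 that by auto
  have \<beta>: "\<beta> b a \<in> carrier A" if "b \<in> carrier B" "a \<in> carrier A" for a b
    using that by (intro auto_closed[OF hom_AutoGroup_auto[OF \<beta>_hom]])
  have S: "S ((inv\<^bsub>AutoGroup K\<^esub> \<nu> (T a)) (\<kappa>1 a)) \<in> carrier L" if "a \<in> carrier A" for a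
    using that by (intro S_closed auto_closed[OF H.K.inv_auto[OF \<nu>_auto]] T_closed k)
  have op: "G.twist \<kappa>2 (R h) = R (H.twist \<kappa>1 h)
      \<longleftrightarrow> S ((inv\<^bsub>AutoGroup K\<^esub> \<nu> (T (proj1 E h))) (\<kappa>1 (proj1 E h))) = \<kappa>2 (T (proj1 E h))"
    if h: "h \<in> carrier H" for h
    using h k l S[OF H.p.hom_closed[OF h]] T_closed[OF H.p.hom_closed[OF h]]
    by (auto simp: H.twist_def G.twist_def R_closed proj_op R_mult_inc1)
  have act: "H.twist \<kappa>1 (\<phi> g h) = \<phi> (G.twist \<kappa>2 g) (H.twist \<kappa>1 h)
      \<longleftrightarrow> \<nu> (proj2 E g) (f (\<kappa>2 (proj2 E g)) (proj1 E h) \<otimes>\<^bsub>K\<^esub> \<kappa>1 (proj1 E h))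
        = \<kappa>1 (\<beta> (proj2 E g) (proj1 E h))"
    if g: "g \<in> carrier G" and h: "h \<in> carrier H" for g h
  proof -
    define a where "a = proj1 E h"
    define b where "b = proj2 E g"
    have ab: "a \<in> carrier A" "b \<in> carrier B" using g h by (simp_all add: a_def b_def)
    have 1: "H.twist \<kappa>1 (\<phi> g h) = \<phi> g h \<otimes>\<^bsub>H\<^esub> inc1 E (\<kappa>1 (\<beta> b a))"
      using g h by (simp add: H.twist_def proj_act a_def b_def)
    have "\<phi> (G.twist \<kappa>2 g) (H.twist \<kappa>1 h) = \<phi> g (\<phi> (inc2 E (\<kappa>2 b)) (h \<otimes>\<^bsub>H\<^esub> inc1 E (\<kappa>1 a)))"
      using g h k[OF ab(1)] l[OF ab(2)]
      by (simp add: H.twist_def G.twist_def a_def b_def hom_AutoGroup_mult_apply[OF \<phi>_hom])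
    also have "\<phi> (inc2 E (\<kappa>2 b)) (h \<otimes>\<^bsub>H\<^esub> inc1 E (\<kappa>1 a)) = h \<otimes>\<^bsub>H\<^esub> inc1 E (f (\<kappa>2 b) a \<otimes>\<^bsub>K\<^esub> \<kappa>1 a)"
      using h k[OF ab(1)] l[OF ab(2)] ab
      by (simp add: auto_mult[OF \<phi>_auto] act_inc2_inc1 act_inc2[of _ h] a_def[symmetric] H.H.m_assoc)
    also have "\<phi> g \<dots> = \<phi> g h \<otimes>\<^bsub>H\<^esub> inc1 E (\<nu> b (f (\<kappa>2 b) a \<otimes>\<^bsub>K\<^esub> \<kappa>1 a))"
      using g h k[OF ab(1)] l[OF ab(2)] ab
      by (simp add: auto_mult[OF \<phi>_auto] act_inc1 b_def[symmetric] del: H.i.hom_mult)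
    finally show ?thesis
      using 1 g h k[OF ab(1)] k[OF \<beta>[OF ab(2,1)]] l[OF ab(2)] ab
      by (auto simp: a_def[symmetric] b_def[symmetric] simp del: H.i.hom_mult)
  qed
  have A: "(\<forall>a\<in>carrier A. P a) \<longleftrightarrow> (\<forall>h\<in>carrier H. P (proj1 E h))" for P
    using H.p_surj by (metis (no_types) H.obtain_lift H.p.hom_closed)
  have B: "(\<forall>b\<in>carrier B. P b) \<longleftrightarrow> (\<forall>g\<in>carrier G. P (proj2 E g))" for P
    using G.p_surj by (metis (no_types) G.obtain_lift G.p.hom_closed)
  show ?thesis
    unfolding compatible_def cocycle_def A B using op act by auto
qed

lemma mem_Aut_iff:
  "\<gamma> \<in> carrier (rrb_Aut (mid E)) \<longleftrightarrow>
    fst \<gamma> \<in> auto H \<and> snd \<gamma> \<in> auto G \<and> compatible (fst \<gamma>) (snd \<gamma>)"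
  by (cases \<gamma>)
    (auto simp: rrb_Aut_def rrb_iso_def rrb_hom_def compatible_def auto_def Bij_def iso_def)

lemma mem_Aut_fix_iff:
  "\<gamma> \<in> carrier (rrb_Aut_fix \<A> \<K> E) \<longleftrightarrow>
    fst \<gamma> \<in> H.Stab \<and> snd \<gamma> \<in> G.Stab \<and> compatible (fst \<gamma>) (snd \<gamma>)"
proof
  assume "\<gamma> \<in> carrier (rrb_Aut_fix \<A> \<K> E)"
  then have \<gamma>: "\<gamma> \<in> carrier (rrb_Aut (mid E))"
    and norm: "fst \<gamma> ` inc1 E ` carrier K = inc1 E ` carrier K"
      "snd \<gamma> ` inc2 E ` carrier L = inc2 E ` carrier L"
    and restr: "rrb_restr \<K> E \<gamma> = \<one>\<^bsub>rrb_Aut \<K>\<^esub>"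
    and "\<exists>s\<in>rrb_sections \<A> E. rrb_induced \<A> E s \<gamma> = \<one>\<^bsub>rrb_Aut \<A>\<^esub>"
    by (simp_all add: rrb_Aut_fix_def rrb_Aut_norm_def)
  then obtain sH sG where s: "(sH, sG) \<in> rrb_sections \<A> E"
    and ind: "rrb_induced \<A> E (sH, sG) \<gamma> = \<one>\<^bsub>rrb_Aut \<A>\<^esub>"
    by auto
  have a: "fst \<gamma> \<in> auto H" "snd \<gamma> \<in> auto G" "compatible (fst \<gamma>) (snd \<gamma>)"
    using \<gamma> by (simp_all add: mem_Aut_iff)
  have fix1: "\<forall>k\<in>carrier K. fst \<gamma> (inc1 E k) = inc1 E k"
    and fix2: "\<forall>l\<in>carrier L. snd \<gamma> (inc2 E l) = inc2 E l"
    using restr H.restriction_id_iff[OF norm(1)] G.restriction_id_iff[OF norm(2)]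
    by (simp_all add: rrb_restr_def rrb_Aut_def AutoGroup_one)
  have "\<forall>h\<in>carrier H. proj1 E (fst \<gamma> h) = proj1 E h"
    "\<forall>g\<in>carrier G. proj2 E (snd \<gamma> g) = proj2 E g"
    using ind H.induced_id_iff[OF a(1) bspec[OF fix1] sectionsD(1,2)[OF s]]
      G.induced_id_iff[OF a(2) bspec[OF fix2] sectionsD(3,4)[OF s]]
    by (simp_all add: rrb_induced_def rrb_Aut_def AutoGroup_one)
  then show "fst \<gamma> \<in> H.Stab \<and> snd \<gamma> \<in> G.Stab \<and> compatible (fst \<gamma>) (snd \<gamma>)"
    using a fix1 fix2 by (simp add: H.Stab_def G.Stab_def)
next
  assume *: "fst \<gamma> \<in> H.Stab \<and> snd \<gamma> \<in> G.Stab \<and> compatible (fst \<gamma>) (snd \<gamma>)"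
  note S1 = H.Stab_D[OF conjunct1[OF *]] and S2 = G.Stab_D[OF conjunct1[OF conjunct2[OF *]]]
  obtain sH sG where s: "(sH, sG) \<in> rrb_sections \<A> E" by (rule obtain_sections)
  have norm: "fst \<gamma> ` inc1 E ` carrier K = inc1 E ` carrier K"
    "snd \<gamma> ` inc2 E ` carrier L = inc2 E ` carrier L"
    by (simp_all add: image_image S1(2) S2(2) cong: image_cong_simp)
  have "rrb_restr \<K> E \<gamma> = \<one>\<^bsub>rrb_Aut \<K>\<^esub>"
    using H.restriction_id_iff[OF norm(1)] G.restriction_id_iff[OF norm(2)] S1(2) S2(2)
    by (simp add: rrb_restr_def rrb_Aut_def AutoGroup_one)
  moreover have "rrb_induced \<A> E (sH, sG) \<gamma> = \<one>\<^bsub>rrb_Aut \<A>\<^esub>"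
    using H.induced_id_iff[OF S1(1,2) sectionsD(1,2)[OF s]] S1(3)
      G.induced_id_iff[OF S2(1,2) sectionsD(3,4)[OF s]] S2(3)
    by (simp add: rrb_induced_def rrb_Aut_def AutoGroup_one)
  ultimately show "\<gamma> \<in> carrier (rrb_Aut_fix \<A> \<K> E)"
    using norm s * S1(1) S2(1) by (auto simp: rrb_Aut_fix_def rrb_Aut_norm_def mem_Aut_iff)
qed

lemma Aut_fix_update:
  "rrb_Aut_fix \<A> \<K> E = (AutoGroup H \<times>\<times> AutoGroup G)\<lparr>carrier := carrier (rrb_Aut_fix \<A> \<K> E)\<rparr>"
  by (simp add: rrb_Aut_fix_def rrb_Aut_norm_def rrb_Aut_def)

lemma compatible_comp:
  assumes "compatible \<gamma>1 \<gamma>2" "compatible \<delta>1 \<delta>2" "\<gamma>1 \<in> auto H" "\<gamma>2 \<in> auto G" "\<delta>1 \<in> auto H" "\<delta>2 \<in> auto G"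
  shows "compatible (\<gamma>1 \<otimes>\<^bsub>AutoGroup H\<^esub> \<delta>1) (\<gamma>2 \<otimes>\<^bsub>AutoGroup G\<^esub> \<delta>2)"
  using assms(1,2) auto_closed[OF assms(5)] auto_closed[OF assms(6)]
  by (simp add: compatible_def AutoGroup_mult assms(3-6) compose_eq R_closed)

lemma compatible_inv:
  assumes c: "compatible \<gamma>1 \<gamma>2" and a1: "\<gamma>1 \<in> auto H" and a2: "\<gamma>2 \<in> auto G"
  shows "compatible (inv\<^bsub>AutoGroup H\<^esub> \<gamma>1) (inv\<^bsub>AutoGroup G\<^esub> \<gamma>2)"
proof -
  note i1 = H.H.auto_inv_apply[OF a1] and i2 = G.H.auto_inv_apply[OF a2]
  have op: "\<gamma>2 (R h) = R (\<gamma>1 h)" if "h \<in> carrier H" for h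
    using c that unfolding compatible_def by blast
  have act: "\<gamma>1 (\<phi> g h) = \<phi> (\<gamma>2 g) (\<gamma>1 h)" if "g \<in> carrier G" "h \<in> carrier H" for g h
    using c that unfolding compatible_def by blast
  show ?thesis
    unfolding compatible_def
  proof (intro conjI ballI)
    fix h assume h: "h \<in> carrier H"
    define h' where "h' = (inv\<^bsub>AutoGroup H\<^esub> \<gamma>1) h"
    have h': "h' \<in> carrier H" "\<gamma>1 h' = h"
      using h by (simp_all add: h'_def i1 auto_closed[OF H.H.inv_auto[OF a1]])
    have "(inv\<^bsub>AutoGroup G\<^esub> \<gamma>2) (R h) = (inv\<^bsub>AutoGroup G\<^esub> \<gamma>2) (\<gamma>2 (R h'))"
      using op[OF h'(1)] h'(2) by simp
    then show "(inv\<^bsub>AutoGroup G\<^esub> \<gamma>2) (R h) = R ((inv\<^bsub>AutoGroup H\<^esub> \<gamma>1) h)"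
      using i2(2)[OF R_closed[OF h'(1)]] by (simp add: h'_def)
    fix g assume g: "g \<in> carrier G"
    define g' where "g' = (inv\<^bsub>AutoGroup G\<^esub> \<gamma>2) g"
    have g': "g' \<in> carrier G" "\<gamma>2 g' = g"
      using g by (simp_all add: g'_def i2 auto_closed[OF G.H.inv_auto[OF a2]])
    have "(inv\<^bsub>AutoGroup H\<^esub> \<gamma>1) (\<phi> g h) = (inv\<^bsub>AutoGroup H\<^esub> \<gamma>1) (\<gamma>1 (\<phi> g' h'))"
      using act[OF g'(1) h'(1)] h'(2) g'(2) by simp
    then show "(inv\<^bsub>AutoGroup H\<^esub> \<gamma>1) (\<phi> g h)
        = \<phi> ((inv\<^bsub>AutoGroup G\<^esub> \<gamma>2) g) ((inv\<^bsub>AutoGroup H\<^esub> \<gamma>1) h)"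
      using i1(2)[OF \<phi>_closed[OF g'(1) h'(1)]] by (simp add: h'_def g'_def)
  qed
qed

lemma group_Aut_fix: "group (rrb_Aut_fix \<A> \<K> E)"
proof -
  let ?P = "AutoGroup H \<times>\<times> AutoGroup G"
  interpret P: group ?P
    by (rule DirProd_group[OF H.H.AutoGroup G.H.AutoGroup])
  note sub1 = H.subgroup_Stab and sub2 = G.subgroup_Stab
  have "subgroup (carrier (rrb_Aut_fix \<A> \<K> E)) ?P"
  proof (rule P.subgroupI)
    show "carrier (rrb_Aut_fix \<A> \<K> E) \<subseteq> carrier ?P"
      using H.Stab_D(1) G.Stab_D(1)
      by (auto simp: mem_Aut_fix_iff carrier_AutoGroup)
    have "\<one>\<^bsub>?P\<^esub> \<in> carrier (rrb_Aut_fix \<A> \<K> E)"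
      using subgroup.one_closed[OF sub1] subgroup.one_closed[OF sub2]
      by (simp add: mem_Aut_fix_iff compatible_def AutoGroup_one R_closed)
    then show "carrier (rrb_Aut_fix \<A> \<K> E) \<noteq> {}" by blast
  next
    fix \<gamma> assume "\<gamma> \<in> carrier (rrb_Aut_fix \<A> \<K> E)"
    then have \<gamma>: "fst \<gamma> \<in> H.Stab" "snd \<gamma> \<in> G.Stab" "compatible (fst \<gamma>) (snd \<gamma>)"
      by (simp_all add: mem_Aut_fix_iff)
    note a = H.Stab_D(1)[OF \<gamma>(1)] G.Stab_D(1)[OF \<gamma>(2)]
    have "inv\<^bsub>?P\<^esub> \<gamma> = (inv\<^bsub>AutoGroup H\<^esub> fst \<gamma>, inv\<^bsub>AutoGroup G\<^esub> snd \<gamma>)"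
      using inv_DirProd[OF H.H.AutoGroup G.H.AutoGroup, of "fst \<gamma>" "snd \<gamma>"] a
      by (simp add: carrier_AutoGroup)
    then show "inv\<^bsub>?P\<^esub> \<gamma> \<in> carrier (rrb_Aut_fix \<A> \<K> E)"
      using \<gamma> a by (simp add: mem_Aut_fix_iff compatible_inv
          subgroup.m_inv_closed[OF sub1] subgroup.m_inv_closed[OF sub2])
  next
    fix \<gamma> \<delta> assume "\<gamma> \<in> carrier (rrb_Aut_fix \<A> \<K> E)" "\<delta> \<in> carrier (rrb_Aut_fix \<A> \<K> E)"
    then have \<gamma>: "fst \<gamma> \<in> H.Stab" "snd \<gamma> \<in> G.Stab" "compatible (fst \<gamma>) (snd \<gamma>)"
      and \<delta>: "fst \<delta> \<in> H.Stab" "snd \<delta> \<in> G.Stab" "compatible (fst \<delta>) (snd \<delta>)"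
      by (simp_all add: mem_Aut_fix_iff)
    show "\<gamma> \<otimes>\<^bsub>?P\<^esub> \<delta> \<in> carrier (rrb_Aut_fix \<A> \<K> E)"
      using \<gamma> \<delta> H.Stab_D(1)[OF \<gamma>(1)] G.Stab_D(1)[OF \<gamma>(2)]
        H.Stab_D(1)[OF \<delta>(1)] G.Stab_D(1)[OF \<delta>(2)]
      by (simp add: mem_Aut_fix_iff mult_DirProd' compatible_comp
          subgroup.m_closed[OF sub1] subgroup.m_closed[OF sub2])
  qed
  then show ?thesis by (subst Aut_fix_update) (rule P.subgroup_imp_group)
qed

definition twists :: "('a \<Rightarrow> 'k) \<times> ('b \<Rightarrow> 'l) \<Rightarrow> ('h \<Rightarrow> 'h) \<times> ('g \<Rightarrow> 'g)" where
  "twists = map_prod H.twist G.twist"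

abbreviation "Z1 \<equiv> Z1_RRB \<A> \<K> \<nu> \<mu> \<sigma> f"
abbreviation "AutF \<equiv> rrb_Aut_fix \<A> \<K> E"

lemma inj_on_twists:
  "inj_on twists ((carrier A \<rightarrow>\<^sub>E carrier K) \<times> (carrier B \<rightarrow>\<^sub>E carrier L))"
  unfolding twists_def by (intro map_prod_inj_on H.inj_on_twist G.inj_on_twist)

lemma carrier_Z1_subset:
  "carrier Z1 \<subseteq> (carrier A \<rightarrow>\<^sub>E carrier K) \<times> (carrier B \<rightarrow>\<^sub>E carrier L)"
  unfolding carrier_Z1 H.Der_def G.Der_def by blast

lemma bij_betw_twists: "bij_betw twists (carrier Z1) (carrier AutF)"
proof (rule bij_betw_imageI)
  show "inj_on twists (carrier Z1)"
    by (rule inj_on_subset[OF inj_on_twists carrier_Z1_subset])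
  show "twists ` carrier Z1 = carrier AutF"
  proof (intro equalityI subsetI)
    fix \<gamma> assume "\<gamma> \<in> twists ` carrier Z1"
    then obtain \<kappa>1 \<kappa>2 where \<kappa>: "\<kappa>1 \<in> H.Der" "\<kappa>2 \<in> G.Der" "cocycle \<kappa>1 \<kappa>2"
      and \<gamma>: "\<gamma> = (H.twist \<kappa>1, G.twist \<kappa>2)"
      by (auto simp: carrier_Z1 twists_def)
    have "\<kappa>1 \<in> carrier A \<rightarrow> carrier K" "\<kappa>2 \<in> carrier B \<rightarrow> carrier L"
      using \<kappa>(1,2) unfolding H.Der_def G.Der_def by auto
    then show "\<gamma> \<in> carrier AutF"
      using \<kappa> by (simp add: \<gamma> mem_Aut_fix_iff H.twist_Stab G.twist_Stab compatible_twist_iff)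
  next
    fix \<gamma> assume "\<gamma> \<in> carrier AutF"
    then have \<gamma>: "fst \<gamma> \<in> H.Stab" "snd \<gamma> \<in> G.Stab" "compatible (fst \<gamma>) (snd \<gamma>)"
      by (simp_all add: mem_Aut_fix_iff)
    obtain \<kappa>1 where 1: "\<kappa>1 \<in> H.Der" "H.twist \<kappa>1 = fst \<gamma>" using \<gamma>(1) by (rule H.Stab_twist)
    obtain \<kappa>2 where 2: "\<kappa>2 \<in> G.Der" "G.twist \<kappa>2 = snd \<gamma>" using \<gamma>(2) by (rule G.Stab_twist)
    have "\<kappa>1 \<in> carrier A \<rightarrow> carrier K" "\<kappa>2 \<in> carrier B \<rightarrow> carrier L"
      using 1(1) 2(1) unfolding H.Der_def G.Der_def by auto
    then have "cocycle \<kappa>1 \<kappa>2"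
      using \<gamma>(3) 1(2) 2(2) compatible_twist_iff by metis
    then have "(\<kappa>1, \<kappa>2) \<in> carrier Z1" using 1(1) 2(1) by (simp add: carrier_Z1)
    moreover have "\<gamma> = twists (\<kappa>1, \<kappa>2)" using 1(2) 2(2) by (simp add: twists_def)
    ultimately show "\<gamma> \<in> twists ` carrier Z1" by blast
  qed
qed

lemma twists_mult:
  assumes "\<kappa> \<in> carrier Z1" "\<rho> \<in> carrier Z1"
  shows "twists (\<kappa> \<otimes>\<^bsub>Z1\<^esub> \<rho>) = twists \<kappa> \<otimes>\<^bsub>AutF\<^esub> twists \<rho>"
proof -
  have \<kappa>: "fst \<kappa> \<in> H.Der" "snd \<kappa> \<in> G.Der" and \<rho>: "fst \<rho> \<in> H.Der" "snd \<rho> \<in> G.Der"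
    using assms by (auto simp: carrier_Z1)
  have Pi: "fst \<kappa> \<in> carrier A \<rightarrow> carrier K" "fst \<rho> \<in> carrier A \<rightarrow> carrier K"
    "snd \<kappa> \<in> carrier B \<rightarrow> carrier L" "snd \<rho> \<in> carrier B \<rightarrow> carrier L"
    using \<kappa> \<rho> unfolding H.Der_def G.Der_def by auto
  have "twists \<kappa> \<otimes>\<^bsub>AutF\<^esub> twists \<rho> =
    (H.twist (fst \<kappa>) \<otimes>\<^bsub>AutoGroup H\<^esub> H.twist (fst \<rho>), G.twist (snd \<kappa>) \<otimes>\<^bsub>AutoGroup G\<^esub> G.twist (snd \<rho>))"
    by (subst Aut_fix_update) (simp add: twists_def mult_DirProd')
  also have "\<dots> = twists (\<kappa> \<otimes>\<^bsub>Z1\<^esub> \<rho>)"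
    using \<kappa> \<rho> by (simp add: AutoGroup_mult H.Stab_D(1)[OF H.twist_Stab] G.Stab_D(1)[OF G.twist_Stab]
        H.twist_mult[OF Pi(1,2)] G.twist_mult[OF Pi(3,4)] twists_def Z1_RRB_def case_prod_beta)
  finally show ?thesis by simp
qed

lemma iso_inv_twists: "inv_into (carrier Z1) twists \<in> iso AutF Z1"
proof -
  let ?\<Psi> = "inv_into (carrier Z1) twists"
  have bij: "bij_betw ?\<Psi> (carrier AutF) (carrier Z1)"
    by (rule bij_betw_inv_into[OF bij_betw_twists])
  interpret AutF: group AutF by (rule group_Aut_fix)
  have tw: "twists (?\<Psi> \<gamma>) = \<gamma>" if "\<gamma> \<in> carrier AutF" for \<gamma>
    by (rule bij_betw_inv_into_right[OF bij_betw_twists that])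
  have \<Psi>: "?\<Psi> \<gamma> \<in> carrier Z1" if "\<gamma> \<in> carrier AutF" for \<gamma>
    using bij that by (rule bij_betw_apply)
  have "?\<Psi> (\<gamma> \<otimes>\<^bsub>AutF\<^esub> \<delta>) = ?\<Psi> \<gamma> \<otimes>\<^bsub>Z1\<^esub> ?\<Psi> \<delta>"
    if *: "\<gamma> \<in> carrier AutF" "\<delta> \<in> carrier AutF" for \<gamma> \<delta>
  proof (rule inj_onD[OF inj_on_twists])
    show "twists (?\<Psi> (\<gamma> \<otimes>\<^bsub>AutF\<^esub> \<delta>)) = twists (?\<Psi> \<gamma> \<otimes>\<^bsub>Z1\<^esub> ?\<Psi> \<delta>)"
      using * by (simp add: tw twists_mult \<Psi>)
    show "?\<Psi> (\<gamma> \<otimes>\<^bsub>AutF\<^esub> \<delta>) \<in> (carrier A \<rightarrow>\<^sub>E carrier K) \<times> (carrier B \<rightarrow>\<^sub>E carrier L)"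
      using * by (intro subsetD[OF carrier_Z1_subset] \<Psi> AutF.m_closed)
    have "?\<Psi> \<gamma> \<in> (carrier A \<rightarrow>\<^sub>E carrier K) \<times> (carrier B \<rightarrow>\<^sub>E carrier L)"
      "?\<Psi> \<delta> \<in> (carrier A \<rightarrow>\<^sub>E carrier K) \<times> (carrier B \<rightarrow>\<^sub>E carrier L)"
      using subsetD[OF carrier_Z1_subset \<Psi>] * by blast+
    then show "?\<Psi> \<gamma> \<otimes>\<^bsub>Z1\<^esub> ?\<Psi> \<delta> \<in> (carrier A \<rightarrow>\<^sub>E carrier K) \<times> (carrier B \<rightarrow>\<^sub>E carrier L)"
      by (auto simp: Z1_RRB_def case_prod_beta mem_Times_iff PiE_mem)
  qed
  then show ?thesis using bij \<Psi> by (simp add: iso_def hom_def)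
qed

lemma group_Z1: "group Z1"
proof -
  let ?\<Psi> = "inv_into (carrier Z1) twists"
  have one: "\<one>\<^bsub>AutF\<^esub> \<in> carrier AutF"
    using group.is_monoid[OF group_Aut_fix] by (rule monoid.one_closed)
  have "?\<Psi> \<one>\<^bsub>AutF\<^esub> = \<one>\<^bsub>Z1\<^esub>"
  proof (rule inj_onD[OF inj_on_twists])
    have "twists \<one>\<^bsub>Z1\<^esub> = \<one>\<^bsub>AutF\<^esub>"
      by (subst Aut_fix_update)
        (simp add: twists_def Z1_RRB_def H.twist_one G.twist_one AutoGroup_one)
    then show "twists (?\<Psi> \<one>\<^bsub>AutF\<^esub>) = twists \<one>\<^bsub>Z1\<^esub>"
      using bij_betw_inv_into_right[OF bij_betw_twists one] by simp
    show "?\<Psi> \<one>\<^bsub>AutF\<^esub> \<in> (carrier A \<rightarrow>\<^sub>E carrier K) \<times> (carrier B \<rightarrow>\<^sub>E carrier L)"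
      using bij_betw_apply[OF bij_betw_inv_into[OF bij_betw_twists] one] carrier_Z1_subset by blast
    show "\<one>\<^bsub>Z1\<^esub> \<in> (carrier A \<rightarrow>\<^sub>E carrier K) \<times> (carrier B \<rightarrow>\<^sub>E carrier L)"
      by (simp add: Z1_RRB_def)
  qed
  then show ?thesis
    using group.iso_imp_img_group[OF group_Aut_fix iso_inv_twists] by simp
qed

end

lemma rrb_ext_equiv_refl:
  assumes "rrb_extension \<A> \<K> E"
  shows "rrb_ext_equiv \<A> \<K> E E"
proof -
  have "(id, id) \<in> rrb_iso (mid E) (mid E)"
    by (auto simp: rrb_iso_def rrb_hom_def hom_def iso_def)
  then show ?thesis
    unfolding rrb_ext_equiv_def by (intro conjI assms bexI[of _ "(id, id)"]) simp_all
qed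

lemma rrb_assoc_action_equiv:
  assumes equiv: "rrb_ext_equiv \<A> \<K> E E'" and act: "rrb_assoc_action \<A> \<K> E \<nu> \<mu> \<sigma> f"
  shows "rrb_assoc_action \<A> \<K> E' \<nu> \<mu> \<sigma> f"
proof -
  let ?H = "rrbH (mid E)" and ?G = "rrbG (mid E)"
  let ?H' = "rrbH (mid E')" and ?G' = "rrbG (mid E')"
  obtain \<psi> \<eta> where iso: "(\<psi>, \<eta>) \<in> rrb_iso (mid E) (mid E')"
    and inc: "\<And>k. k \<in> carrier (rrbH \<K>) \<Longrightarrow> inc1 E' k = \<psi> (inc1 E k)"
      "\<And>l. l \<in> carrier (rrbG \<K>) \<Longrightarrow> inc2 E' l = \<eta> (inc2 E l)"
    and proj: "\<And>h. h \<in> carrier ?H \<Longrightarrow> proj1 E' (\<psi> h) = proj1 E h"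
      "\<And>g. g \<in> carrier ?G \<Longrightarrow> proj2 E' (\<eta> g) = proj2 E g"
    and ext: "rrb_extension \<A> \<K> E" and ext': "rrb_extension \<A> \<K> E'"
    using equiv unfolding rrb_ext_equiv_def by fastforce
  have \<psi>\<phi>: "\<psi> (rrb_act (mid E) g h) = rrb_act (mid E') (\<eta> g) (\<psi> h)"
    if "g \<in> carrier ?G" "h \<in> carrier ?H" for g h
    using iso that by (simp add: rrb_iso_def rrb_hom_def)
  have group: "group ?H" "group ?G" "group ?H'" "group ?G'"
    and \<phi>: "rrb_act (mid E) \<in> hom ?G (AutoGroup ?H)"
    using ext ext' by (simp_all add: rrb_extension_def rrb_group_def)
  interpret \<psi>: group_hom ?H ?H' \<psi>
    using iso group by (simp add: group_hom_def group_hom_axioms_def rrb_iso_def rrb_hom_def)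
  interpret \<eta>: group_hom ?G ?G' \<eta>
    using iso group by (simp add: group_hom_def group_hom_axioms_def rrb_iso_def rrb_hom_def)
  have closed: "k \<in> carrier (rrbH \<K>) \<Longrightarrow> inc1 E k \<in> carrier ?H"
    "l \<in> carrier (rrbG \<K>) \<Longrightarrow> inc2 E l \<in> carrier ?G" for k l
    using ext by (auto simp: rrb_extension_def rrb_hom_def hom_def)
  have maps: "\<nu> \<in> carrier (rrbG \<A>) \<rightarrow> auto (rrbH \<K>)" "\<mu> \<in> carrier (rrbH \<A>) \<rightarrow> auto (rrbH \<K>)"
    "\<sigma> \<in> carrier (rrbG \<A>) \<rightarrow> auto (rrbG \<K>)"
    "f \<in> carrier (rrbG \<K>) \<rightarrow> carrier (rrbH \<A>) \<rightarrow> carrier (rrbH \<K>)"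
    using act unfolding rrb_assoc_action_def by blast+
  obtain sH sG where s: "(sH, sG) \<in> rrb_sections \<A> E"
    and \<nu>: "\<And>b k. \<lbrakk>b \<in> carrier (rrbG \<A>); k \<in> carrier (rrbH \<K>)\<rbrakk> \<Longrightarrow>
      inc1 E (\<nu> b k) = rrb_act (mid E) (sG b) (inc1 E k)"
    and \<mu>: "\<And>a k. \<lbrakk>a \<in> carrier (rrbH \<A>); k \<in> carrier (rrbH \<K>)\<rbrakk> \<Longrightarrow>
      inc1 E (\<mu> a k) = inv\<^bsub>?H\<^esub> sH a \<otimes>\<^bsub>?H\<^esub> inc1 E k \<otimes>\<^bsub>?H\<^esub> sH a"
    and \<sigma>: "\<And>b l. \<lbrakk>b \<in> carrier (rrbG \<A>); l \<in> carrier (rrbG \<K>)\<rbrakk> \<Longrightarrow>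
      inc2 E (\<sigma> b l) = inv\<^bsub>?G\<^esub> sG b \<otimes>\<^bsub>?G\<^esub> inc2 E l \<otimes>\<^bsub>?G\<^esub> sG b"
    and f: "\<And>l a. \<lbrakk>l \<in> carrier (rrbG \<K>); a \<in> carrier (rrbH \<A>)\<rbrakk> \<Longrightarrow>
      inc1 E (f l a) = inv\<^bsub>?H\<^esub> sH a \<otimes>\<^bsub>?H\<^esub> rrb_act (mid E) (inc2 E l) (sH a)"
    using act unfolding rrb_assoc_action_def by fast
  have sH: "sH a \<in> carrier ?H" "proj1 E (sH a) = a" if "a \<in> carrier (rrbH \<A>)" for a
    using s that by (auto simp: rrb_sections_def)
  have sG: "sG b \<in> carrier ?G" "proj2 E (sG b) = b" if "b \<in> carrier (rrbG \<A>)" for b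
    using s that by (auto simp: rrb_sections_def)
  have one: "sH \<one>\<^bsub>rrbH \<A>\<^esub> = \<one>\<^bsub>?H\<^esub>" "sG \<one>\<^bsub>rrbG \<A>\<^esub> = \<one>\<^bsub>?G\<^esub>"
    using s by (auto simp: rrb_sections_def)
  have s': "(\<psi> \<circ> sH, \<eta> \<circ> sG) \<in> rrb_sections \<A> E'"
    unfolding rrb_sections_def by (simp add: Pi_iff sH sG proj one)
  note act_closed = auto_closed[OF hom_AutoGroup_auto[OF \<phi>]]
  note auto_val = maps(1-3)[THEN funcset_mem, THEN auto_closed]
  note f_val = funcset_mem[OF funcset_mem[OF maps(4)]]
  show ?thesis
    unfolding rrb_assoc_action_def
    by (intro conjI maps bexI[OF _ s'])
      (simp add: inc auto_val f_val \<nu> \<mu> \<sigma> f sH sG closed \<psi>\<phi> act_closed)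
qed

theorem theorem4p6:
  fixes \<A> :: "('a, 'b) rrb" and \<K> :: "('k, 'l) rrb"
    and E :: "('k, 'l, 'h, 'g, 'a, 'b) rrb_ext"
    and \<nu> :: "'b \<Rightarrow> 'k \<Rightarrow> 'k" and \<mu> :: "'a \<Rightarrow> 'k \<Rightarrow> 'k"
    and \<sigma> :: "'b \<Rightarrow> 'l \<Rightarrow> 'l" and f :: "'l \<Rightarrow> 'a \<Rightarrow> 'k"
  assumes "rrb_abelian_extension \<A> \<K> E"
    and "rrb_ext_class \<A> \<K> E \<in> rrb_Ext \<A> \<K> \<nu> \<mu> \<sigma> f"
  shows "group (rrb_Aut_fix \<A> \<K> E) \<and> group (Z1_RRB \<A> \<K> \<nu> \<mu> \<sigma> f) \<and>
    rrb_Aut_fix \<A> \<K> E \<cong> Z1_RRB \<A> \<K> \<nu> \<mu> \<sigma> f"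
proof -
  obtain E' where class_eq: "rrb_ext_class \<A> \<K> E = rrb_ext_class \<A> \<K> E'"
    and act: "rrb_assoc_action \<A> \<K> E' \<nu> \<mu> \<sigma> f"
    using assms(2) by (auto simp: rrb_Ext_def)
  have "E \<in> rrb_ext_class \<A> \<K> E"
    using assms(1) by (simp add: rrb_ext_class_def rrb_abelian_extension_def rrb_ext_equiv_refl)
  then have "rrb_ext_equiv \<A> \<K> E' E"
    unfolding class_eq by (simp add: rrb_ext_class_def)
  then have "rrb_assoc_action \<A> \<K> E \<nu> \<mu> \<sigma> f"
    using act by (rule rrb_assoc_action_equiv)
  with assms(1) interpret rrb_action_extension \<A> \<K> E \<nu> \<mu> \<sigma> f
    by unfold_locales
  show ?thesis
    using group_Aut_fix group_Z1 is_isoI[OF iso_inv_twists] by blast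
qed

end
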